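(* Let $N \ge 1$, $L \ge 2$ be integers and $\alpha, \beta \in \{\pm 1\}$. Suppose that it is not the case that both $N$ is even and $\alpha = +1$. Then for every integer $n \ge 1$ the $n$-th Frobenius-Schur indicator of the regular representation of $A = A_{NL}^{\alpha\beta}$ is given by \begin{align*} \nu_n(A) &= \gcd(N,n)\gcd(L,n) \\ &\quad + [\,b_2(n) - 1 \ge b_2(N)\,] \cdot 2L \gcd(N,n) \\ &\quad + [\,b_2(n)-1 \ge b_2(N) \text{ and } b_2(n)-1 \ge b_2(L)\,] \cdot \varepsilon_{NL}(n) \gcd(N,n)\gcd(L,n) \end{align*} where \[ \varepsilon_{NL}(n) = (-\alpha)^{[b_2(n)=1]} (-1)^{[b_2(n) = b_2(N)+1]} \beta^{[b_2(n) = b_2(L)+1]}. \]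
   Context: For a positive integer $m$, $b_2(m)$ is the largest integer $i \ge 0$ such that $2^i$ divides $m$. The Iverson bracket $[P]$ equals $1$ if the condition $P$ holds and $0$ otherwise. Suzuki's Hopf algebra $A_{NL}^{\alpha\beta}$ over $\mathbb{C}$ is generated as an algebra by $x_{ij}$ ($i,j \in \mathbb{Z}_2$) with defining relations: $x_{00}^2 = x_{11}^2$; $x_{01}^2 = x_{10}^2$; $x_{00}^{2N} + \alpha x_{01}^{2N} = 1$; $x_{ij}x_{kl} = 0$ whenever $i-j \ne k-l$ in $\mathbb{Z}_2$; $x_{00}x_{11}x_{00}\cdots = x_{11}x_{00}x_{11}\cdots$ (alternating products with $L$ factors on each side); $x_{01}x_{10}x_{01}\cdots = \beta\, x_{10}x_{01}x_{10}\cdots$ (alternating products with $L$ factors on each side). The coalgebra structure is $\Delta(x_{ij}) = x_{i0}\otimes x_{0j} + x_{i1} \otimes x_{1j}$, $\varepsilon(x_{ij}) = \delta_{ij}$, and the antipode is $S(x_{ij}) = x_{ji}^{4N-1}$. It is semisimple of dimension $4NL$. For a finite-dimensional semisimple Hopf algebra $H$ over $\mathbb{C}$, $\nu_n(H) = \chi_H(\Lambda_{(1)} \Lambda_{(2)} \cdots \Lambda_{(n)})$, where $\Lambda \in H$ is the integral with $\varepsilon(\Lambda) = 1$, Sweedler notation is used for the iterated comultiplication, and $\chi_H$ is the character of the (left) regular representation. *)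

theory Defs
  imports
    Complex_Main
    "HOL-Algebra.QuotRing"
    "HOL-Algebra.Module"
    "HOL-Library.Poly_Mapping"
    "HOL-Library.Product_Plus"
    "HOL-Library.Z2"
    "HOL-Computational_Algebra.Primes"
begin

section \<open>Linear algebra over the complex numbers on carrier sets\<close>

text \<open>
  Complex vector spaces and algebras are given by the record \<open>(complex, 'a) module\<close>
  of HOL-Algebra. A finite formal combination of elements of a type \<open>'k\<close> is an
  element of \<open>'k \<Rightarrow>\<^sub>0 complex\<close>.
\<close>

definition lin_ext :: "('k \<Rightarrow> ('m \<Rightarrow>\<^sub>0 complex)) \<Rightarrow> ('k \<Rightarrow>\<^sub>0 complex) \<Rightarrow> ('m \<Rightarrow>\<^sub>0 complex)" where
  "lin_ext f s = (\<Sum>k\<in>Poly_Mapping.keys s. Poly_Mapping.map ((*) (Poly_Mapping.lookup s k)) (f k))"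

text \<open>A representative of a coset; maps on quotients are defined through it.\<close>

definition rep :: "'a set \<Rightarrow> 'a" where
  "rep X = (SOME x. x \<in> X)"

definition lin_comb :: "(complex, 'a, 'r) module_scheme \<Rightarrow> 'a list \<Rightarrow> complex list \<Rightarrow> 'a" where
  "lin_comb V bs cs = finsum V (\<lambda>i. (cs ! i) \<odot>\<^bsub>V\<^esub> (bs ! i)) {..<length bs}"

definition is_basis :: "(complex, 'a, 'r) module_scheme \<Rightarrow> 'a list \<Rightarrow> bool" where
  "is_basis V bs \<longleftrightarrow> set bs \<subseteq> carrier V \<and>
     (\<forall>v\<in>carrier V. \<exists>!cs. length cs = length bs \<and> lin_comb V bs cs = v)"

definition coords :: "(complex, 'a, 'r) module_scheme \<Rightarrow> 'a list \<Rightarrow> 'a \<Rightarrow> complex list" where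
  "coords V bs v = (THE cs. length cs = length bs \<and> lin_comb V bs cs = v)"

text \<open>Trace of an endomorphism of a finite-dimensional space; it does not depend on the
  basis chosen.\<close>

definition lin_trace :: "(complex, 'a, 'r) module_scheme \<Rightarrow> ('a \<Rightarrow> 'a) \<Rightarrow> complex" where
  "lin_trace V T =
     (let bs = (SOME bs. is_basis V bs) in \<Sum>i<length bs. coords V bs (T (bs ! i)) ! i)"


section \<open>Tensor powers\<close>

text \<open>
  \<open>V\<^sup>\<otimes>\<^sup>n\<close> is the space of formal combinations of \<open>n\<close>-tuples (lists of length \<open>n\<close>) of
  elements of \<open>V\<close> modulo the relations expressing multilinearity; its elements are cosets.
  The list \<open>[a\<^sub>1, \<dots>, a\<^sub>n]\<close> stands for \<open>a\<^sub>1 \<otimes> \<dots> \<otimes> a\<^sub>n\<close>.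
\<close>

definition formal_tensors ::
    "(complex, 'a, 'r) module_scheme \<Rightarrow> nat \<Rightarrow> ('a list \<Rightarrow>\<^sub>0 complex) set" where
  "formal_tensors V n =
     {s. \<forall>us\<in>Poly_Mapping.keys s. length us = n \<and> set us \<subseteq> carrier V}"

inductive_set tensor_null ::
    "(complex, 'a, 'r) module_scheme \<Rightarrow> nat \<Rightarrow> ('a list \<Rightarrow>\<^sub>0 complex) set"
  for V :: "(complex, 'a, 'r) module_scheme" and n :: nat
  where
    zero: "0 \<in> tensor_null V n"
  | plus: "s \<in> tensor_null V n \<Longrightarrow> t \<in> tensor_null V n \<Longrightarrow> s + t \<in> tensor_null V n"
  | additive:
      "\<lbrakk>set us \<subseteq> carrier V; set ws \<subseteq> carrier V; a \<in> carrier V; b \<in> carrier V;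
        length us + 1 + length ws = n\<rbrakk> \<Longrightarrow>
       Poly_Mapping.single (us @ [a \<oplus>\<^bsub>V\<^esub> b] @ ws) c
         - Poly_Mapping.single (us @ [a] @ ws) c
         - Poly_Mapping.single (us @ [b] @ ws) c \<in> tensor_null V n"
  | homogeneous:
      "\<lbrakk>set us \<subseteq> carrier V; set ws \<subseteq> carrier V; a \<in> carrier V;
        length us + 1 + length ws = n\<rbrakk> \<Longrightarrow>
       Poly_Mapping.single (us @ [k \<odot>\<^bsub>V\<^esub> a] @ ws) c
         - Poly_Mapping.single (us @ [a] @ ws) (c * k) \<in> tensor_null V n"

definition tensor_class ::
    "(complex, 'a, 'r) module_scheme \<Rightarrow> nat \<Rightarrow> ('a list \<Rightarrow>\<^sub>0 complex) \<Rightarrow> ('a list \<Rightarrow>\<^sub>0 complex) set"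
  where
  "tensor_class V n s = {t \<in> formal_tensors V n. t - s \<in> tensor_null V n}"


section \<open>Hopf algebras and Frobenius-Schur indicators\<close>

text \<open>The comultiplication takes values in \<open>H \<otimes> H\<close>, i.e. in cosets \<open>tensor_class H 2 s\<close>.\<close>

record 'a hopf = "(complex, 'a) module" +
  comult :: "'a \<Rightarrow> ('a list \<Rightarrow>\<^sub>0 complex) set"
  counit :: "'a \<Rightarrow> complex"
  antipode :: "'a \<Rightarrow> 'a"

text \<open>\<open>h \<mapsto> h\<^sub>(\<^sub>1\<^sub>) \<otimes> \<dots> \<otimes> h\<^sub>(\<^sub>n\<^sub>)\<close>, obtained by iterating
  \<open>h\<^sub>(\<^sub>1\<^sub>) \<otimes> (h\<^sub>(\<^sub>2\<^sub>) \<otimes> \<dots>)\<close>; the case \<open>n = 0\<close> is the usual convention.\<close>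

fun iterated_comult :: "'a hopf \<Rightarrow> nat \<Rightarrow> 'a \<Rightarrow> ('a list \<Rightarrow>\<^sub>0 complex) set" where
  "iterated_comult H 0 h = tensor_class H 0 (Poly_Mapping.single [] (counit H h))"
| "iterated_comult H (Suc 0) h = tensor_class H 1 (Poly_Mapping.single [h] 1)"
| "iterated_comult H (Suc (Suc n)) h =
     tensor_class H (Suc (Suc n))
       (lin_ext (\<lambda>us. lin_ext (\<lambda>ws. Poly_Mapping.single (us ! 0 # ws) 1)
                        (rep (iterated_comult H (Suc n) (us ! 1))))
                (rep (comult H h)))"

text \<open>The multiplication map \<open>H\<^sup>\<otimes>\<^sup>n \<rightarrow> H\<close>.\<close>

definition tensor_mult :: "'a hopf \<Rightarrow> ('a list \<Rightarrow>\<^sub>0 complex) set \<Rightarrow> 'a" where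
  "tensor_mult H T =
     finsum H (\<lambda>us. Poly_Mapping.lookup (rep T) us \<odot>\<^bsub>H\<^esub> foldr (monoid.mult H) us \<one>\<^bsub>H\<^esub>)
       (Poly_Mapping.keys (rep T))"

text \<open>Two-sided, which for semisimple \<open>H\<close> is the same as one-sided; the element is unique.\<close>

definition normalized_integral :: "'a hopf \<Rightarrow> 'a" where
  "normalized_integral H =
     (THE \<Lambda>. \<Lambda> \<in> carrier H \<and>
        (\<forall>h\<in>carrier H. h \<otimes>\<^bsub>H\<^esub> \<Lambda> = counit H h \<odot>\<^bsub>H\<^esub> \<Lambda> \<and> \<Lambda> \<otimes>\<^bsub>H\<^esub> h = counit H h \<odot>\<^bsub>H\<^esub> \<Lambda>) \<and>
        counit H \<Lambda> = 1)"

definition regular_character :: "'a hopf \<Rightarrow> 'a \<Rightarrow> complex" where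
  "regular_character H a = lin_trace H (\<lambda>h. a \<otimes>\<^bsub>H\<^esub> h)"

definition fs_indicator :: "nat \<Rightarrow> 'a hopf \<Rightarrow> complex" where
  "fs_indicator n H =
     regular_character H (tensor_mult H (iterated_comult H n (normalized_integral H)))"


section \<open>The free algebra\<close>

text \<open>
  \<open>Poly_Mapping\<close> turns \<open>'w \<Rightarrow>\<^sub>0 complex\<close> into the monoid algebra of an additively written,
  not necessarily commutative monoid \<open>'w\<close>. For the free monoid this is the free algebra,
  and for the product of two copies of the free monoid it is the tensor square of the free
  algebra, the pair \<open>(u, v)\<close> being \<open>u \<otimes> v\<close>.
\<close>

datatype 'g fmonoid = FM (letters: "'g list")

instantiation fmonoid :: (type) monoid_add
begin

definition zero_fmonoid :: "'a fmonoid" where "zero_fmonoid = FM []"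

definition plus_fmonoid :: "'a fmonoid \<Rightarrow> 'a fmonoid \<Rightarrow> 'a fmonoid" where
  "plus_fmonoid u v = FM (letters u @ letters v)"

instance
  by standard (simp_all add: zero_fmonoid_def plus_fmonoid_def)

end

text \<open>The letter \<open>(i, j)\<close> with \<open>i\<close>, \<open>j\<close> in the integers modulo 2 is the generator
  \<open>x\<^bsub>ij\<^esub>\<close>.\<close>

type_synonym words = "(bit \<times> bit) fmonoid"
type_synonym free_alg = "words \<Rightarrow>\<^sub>0 complex"

definition gen :: "bit \<Rightarrow> bit \<Rightarrow> free_alg" where
  "gen i j = Poly_Mapping.single (FM [(i, j)]) 1"

definition scalar :: "complex \<Rightarrow> free_alg" where
  "scalar c = Poly_Mapping.single 0 c"

definition free_ring :: "free_alg ring" where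
  "free_ring = \<lparr>carrier = UNIV, monoid.mult = (*), one = 1, zero = 0, add = (+)\<rparr>"

text \<open>The structure maps on the free algebra: \<open>\<Delta>\<close> and \<open>\<epsilon>\<close> are the algebra homomorphisms,
  \<open>S\<close> the algebra antihomomorphism, with the prescribed values on generators.\<close>

definition free_comult :: "free_alg \<Rightarrow> (words \<times> words \<Rightarrow>\<^sub>0 complex)" where
  "free_comult = lin_ext (\<lambda>w. prod_list (map (\<lambda>(i, j).
       Poly_Mapping.single (FM [(i, 0)], FM [(0, j)]) 1
     + Poly_Mapping.single (FM [(i, 1)], FM [(1, j)]) 1) (letters w)))"

definition free_counit :: "free_alg \<Rightarrow> complex" where
  "free_counit f = (\<Sum>w\<in>Poly_Mapping.keys f.
     Poly_Mapping.lookup f w * prod_list (map (\<lambda>(i, j). of_bool (i = j)) (letters w)))"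

definition free_antipode :: "nat \<Rightarrow> free_alg \<Rightarrow> free_alg" where
  "free_antipode N =
     lin_ext (\<lambda>w. prod_list (map (\<lambda>(i, j). gen j i ^ (4 * N - 1)) (rev (letters w))))"


section \<open>Suzuki's Hopf algebras\<close>

text \<open>\<open>alt n a b\<close> is the alternating product \<open>a b a \<dots>\<close> with \<open>n\<close> factors.\<close>

fun alt :: "nat \<Rightarrow> free_alg \<Rightarrow> free_alg \<Rightarrow> free_alg" where
  "alt 0 a b = 1"
| "alt (Suc n) a b = a * alt n b a"

text \<open>A relation \<open>l = r\<close> is encoded as \<open>l - r\<close>.\<close>

definition suzuki_relations :: "nat \<Rightarrow> nat \<Rightarrow> complex \<Rightarrow> complex \<Rightarrow> free_alg set" where
  "suzuki_relations N L \<alpha> \<beta> =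
     {gen 0 0 ^ 2 - gen 1 1 ^ 2,
      gen 0 1 ^ 2 - gen 1 0 ^ 2,
      gen 0 0 ^ (2 * N) + scalar \<alpha> * gen 0 1 ^ (2 * N) - 1,
      alt L (gen 0 0) (gen 1 1) - alt L (gen 1 1) (gen 0 0),
      alt L (gen 0 1) (gen 1 0) - scalar \<beta> * alt L (gen 1 0) (gen 0 1)}
     \<union> {gen i j * gen k l | i j k l. i - j \<noteq> k - l}"

definition suzuki_ideal :: "nat \<Rightarrow> nat \<Rightarrow> complex \<Rightarrow> complex \<Rightarrow> free_alg set" where
  "suzuki_ideal N L \<alpha> \<beta> = genideal free_ring (suzuki_relations N L \<alpha> \<beta>)"

definition suzuki_class :: "nat \<Rightarrow> nat \<Rightarrow> complex \<Rightarrow> complex \<Rightarrow> free_alg \<Rightarrow> free_alg set" where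
  "suzuki_class N L \<alpha> \<beta> f = suzuki_ideal N L \<alpha> \<beta> +>\<^bsub>free_ring\<^esub> f"

definition suzuki_algebra ::
    "nat \<Rightarrow> nat \<Rightarrow> complex \<Rightarrow> complex \<Rightarrow> (complex, free_alg set) module" where
  "suzuki_algebra N L \<alpha> \<beta> =
     (let Q = free_ring Quot suzuki_ideal N L \<alpha> \<beta> in
      \<lparr>carrier = carrier Q, monoid.mult = monoid.mult Q, one = one Q, zero = zero Q, add = add Q,
       smult = (\<lambda>c X. suzuki_class N L \<alpha> \<beta> (scalar c) \<otimes>\<^bsub>Q\<^esub> X)\<rparr>)"

text \<open>The structure maps are induced by those of the free algebra, hence independent of the
  representative: \<open>\<Delta>\<close>, \<open>\<epsilon>\<close> and \<open>S\<close> map the ideal to zero in \<open>A \<otimes> A\<close>, \<open>\<complex>\<close> and \<open>A\<close>.\<close>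

definition suzuki_hopf :: "nat \<Rightarrow> nat \<Rightarrow> complex \<Rightarrow> complex \<Rightarrow> free_alg set hopf" where
  "suzuki_hopf N L \<alpha> \<beta> =
     (let A = suzuki_algebra N L \<alpha> \<beta>;
          cl = (\<lambda>w. suzuki_class N L \<alpha> \<beta> (Poly_Mapping.single w 1)) in
      \<lparr>carrier = carrier A, monoid.mult = monoid.mult A, one = one A, zero = zero A, add = add A,
       smult = smult A,
       comult = (\<lambda>X. tensor_class A 2
         (lin_ext (\<lambda>(u, v). Poly_Mapping.single [cl u, cl v] 1) (free_comult (rep X)))),
       counit = (\<lambda>X. free_counit (rep X)),
       antipode = (\<lambda>X. suzuki_class N L \<alpha> \<beta> (free_antipode N (rep X)))\<rparr>)"


section \<open>The sign\<close>

text \<open>The 2-adic valuation is integer valued so that \<open>b2 n - 1\<close> is not truncated.\<close>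

definition b2 :: "nat \<Rightarrow> int" where
  "b2 m = int (multiplicity 2 m)"

definition eps_NL :: "nat \<Rightarrow> nat \<Rightarrow> complex \<Rightarrow> complex \<Rightarrow> nat \<Rightarrow> complex" where
  "eps_NL N L \<alpha> \<beta> n =
     (- \<alpha>) ^ of_bool (b2 n = 1) * (- 1) ^ of_bool (b2 n = b2 N + 1) * \<beta> ^ of_bool (b2 n = b2 L + 1)"

end

theory Submission
  imports Defs
begin

text \<open>
  The relations split \<open>A\<close> as \<open>A\<^sub>0 \<times> A\<^sub>1\<close>, where \<open>A\<^sub>d\<close> is spanned by the words all of whose letters
  \<open>x\<^bsub>ij\<^esub>\<close> have \<open>i + j = d\<close>. Here \<open>A\<^sub>0\<close> is the group algebra of \<open>\<int>\<^sub>L \<rtimes> \<int>\<^sub>2\<^sub>N\<close> (acting by inversion), with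
  generators \<open>v\<close> and \<open>x\<close>, and \<open>A\<^sub>1\<close> is the twisted form of it with \<open>x\<^sup>2\<^sup>N = \<alpha>\<close> and \<open>v\<^sup>L = \<beta>\<close>. The integral is
  the average \<open>\<Lambda>\<close> of the group elements in \<open>A\<^sub>0\<close>, and the regular character is \<open>2NL\<close> times the functional
  picking the coefficient of the unit in each factor. The comultiplication sends a word \<open>w\<close> of type \<open>0\<close> to
  \<open>w \<otimes> w + w' \<otimes> w''\<close> with \<open>w', w''\<close> of type \<open>1\<close> and first indices as in \<open>w\<close>, respectively exchanged.
  Since \<open>A\<^sub>0 A\<^sub>1 = 0\<close>, multiplying out the iterated comultiplication leaves \<open>w\<^sup>n\<close> and, for even \<open>n\<close>, also
  \<open>(w' w'')\<close> to the power \<open>n/2\<close>. The indicator is thus the number of solutions of \<open>g\<^sup>n = 1\<close> in the group plus a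
  signed count of the \<open>g\<close> for which \<open>(w' w'')\<close> to the power \<open>n/2\<close> is a scalar.

  The ideal of relations is controlled by its annihilator: a functional that vanishes on mixed words and
  factors through a function on \<open>\<langle>x, v | v x = x v\<^sup>-\<^sup>1\<rangle>\<close> which is quasi-periodic with the multipliers above
  kills the ideal, and conversely these functionals separate the elements of the quotient.
\<close>

section \<open>Sums of periodic functions\<close>

text \<open>Passing from \<open>c\<close> to \<open>c + 1\<close> trades the term \<open>F c\<close>
  for \<open>F (int M + c)\<close>, which equals it; induction on \<open>c\<close> in both
  directions does the rest.\<close>

lemma periodic_sum:
  fixes F :: "int \<Rightarrow> complex"
  assumes "\<And>x. F (x + int M) = F x"
  shows "(\<Sum>s<M. F (int s + c)) = (\<Sum>s<M. F (int s))"
proof -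
  have step: "(\<Sum>s<M. F (int s + (c + 1))) = (\<Sum>s<M. F (int s + c))" for c
  proof -
    have "(\<Sum>s<M. F (int (Suc s) + c)) + F c = (\<Sum>s<Suc M. F (int s + c))"
      by (subst sum.lessThan_Suc_shift) (simp add: add.commute)
    also have "\<dots> = (\<Sum>s<M. F (int s + c)) + F c"
      using assms[of c] by (simp add: add.commute)
    finally show ?thesis by (simp add: algebra_simps)
  qed
  show ?thesis
  proof (induction c rule: int_induct[where k = 0])
    case (step1 i)
    then show ?case using step[of i] by simp
  next
    case (step2 i)
    then show ?case using step[of "i - 1"] by simp
  qed simp
qed

text \<open>This range is the one of the exponents of x in normal words, which start at 1 so that no
  normal word is empty.\<close>

lemma periodic_sum_atLeast1:
  fixes F :: "int \<Rightarrow> complex"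
  assumes "\<And>x. F (x + int M) = F x"
  shows "(\<Sum>s\<in>{1..M}. F (int s + c)) = (\<Sum>s<M. F (int s))"
proof -
  have "(\<Sum>s\<in>{1..M}. F (int s + c)) = (\<Sum>s<M. F (int (Suc s) + c))"
    by (rule sum.reindex_bij_witness[of _ Suc "\<lambda>s. s - 1"]) auto
  also have "\<dots> = (\<Sum>s<M. F (int s + (c + 1)))" by (simp add: algebra_simps)
  also have "\<dots> = (\<Sum>s<M. F (int s))" by (rule periodic_sum) (rule assms)
  finally show ?thesis .
qed

lemma sum_dvd_less: "M > 0 \<Longrightarrow> (\<Sum>s<M. of_bool (int M dvd int s)) = (1 :: complex)"
proof -
  assume "M > 0"
  have "(\<Sum>s<M. of_bool (int M dvd int s)) = (\<Sum>s<M. if s = 0 then 1 else 0 :: complex)"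
    by (rule sum.cong) (auto dest: dvd_imp_le)
  with \<open>M > 0\<close> show ?thesis by simp
qed

section \<open>Linear functionals on formal combinations\<close>

definition lin_eval :: "('k \<Rightarrow> complex) \<Rightarrow> ('k \<Rightarrow>\<^sub>0 complex) \<Rightarrow> complex" where
  "lin_eval \<phi> s = (\<Sum>k\<in>Poly_Mapping.keys s. Poly_Mapping.lookup s k * \<phi> k)"

lemma lin_eval_superset:
  assumes "finite S" "Poly_Mapping.keys s \<subseteq> S"
  shows "lin_eval \<phi> s = (\<Sum>k\<in>S. Poly_Mapping.lookup s k * \<phi> k)"
  unfolding lin_eval_def using assms
  by (intro sum.mono_neutral_left) (auto simp: in_keys_iff)

lemma lin_eval_zero [simp]: "lin_eval \<phi> 0 = 0"
  by (simp add: lin_eval_def)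

lemma lin_eval_single [simp]: "lin_eval \<phi> (Poly_Mapping.single k c) = c * \<phi> k"
  by (simp add: lin_eval_def)

lemma lin_eval_one [simp]: "lin_eval \<phi> (1 :: 'k::zero \<Rightarrow>\<^sub>0 complex) = \<phi> 0"
  by (simp flip: single_one)

lemma lin_eval_add [simp]: "lin_eval \<phi> (s + t) = lin_eval \<phi> s + lin_eval \<phi> t"
proof -
  let ?S = "Poly_Mapping.keys s \<union> Poly_Mapping.keys t"
  have "lin_eval \<phi> (s + t) = (\<Sum>k\<in>?S. Poly_Mapping.lookup (s + t) k * \<phi> k)"
    by (rule lin_eval_superset) (auto simp: keys_add)
  also have "\<dots> = lin_eval \<phi> s + lin_eval \<phi> t"
    by (simp add: lin_eval_superset[of ?S s] lin_eval_superset[of ?S t]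
        lookup_add distrib_right sum.distrib)
  finally show ?thesis .
qed

lemma lin_eval_uminus [simp]: "lin_eval \<phi> (- s) = - lin_eval \<phi> s"
  using lin_eval_add[of \<phi> s "- s"] by (simp add: eq_neg_iff_add_eq_0 add.commute)

lemma lin_eval_diff [simp]: "lin_eval \<phi> (s - t) = lin_eval \<phi> s - lin_eval \<phi> t"
  using lin_eval_add[of \<phi> s "- t"] by simp

lemma lin_eval_sum [simp]: "lin_eval \<phi> (sum f S) = (\<Sum>i\<in>S. lin_eval \<phi> (f i))"
  by (induction S rule: infinite_finite_induct) auto

lemma lin_eval_cong:
  "(\<And>k. k \<in> Poly_Mapping.keys s \<Longrightarrow> \<phi> k = \<psi> k) \<Longrightarrow> lin_eval \<phi> s = lin_eval \<psi> s"
  unfolding lin_eval_def by (rule sum.cong) auto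

lemma lin_eval_zero_fun [simp]: "lin_eval (\<lambda>_. 0) s = 0"
  by (simp add: lin_eval_def)

lemma lin_eval_mult_left: "lin_eval (\<lambda>k. c * \<phi> k) s = c * lin_eval \<phi> s"
  by (simp add: lin_eval_def sum_distrib_left algebra_simps)

lemma lin_eval_map [simp]: "lin_eval \<phi> (Poly_Mapping.map ((*) c) s) = c * lin_eval \<phi> s"
proof -
  have "lin_eval \<phi> (Poly_Mapping.map ((*) c) s)
      = (\<Sum>k\<in>Poly_Mapping.keys s. Poly_Mapping.lookup (Poly_Mapping.map ((*) c) s) k * \<phi> k)"
    by (rule lin_eval_superset) (auto simp: in_keys_iff map.rep_eq when_def)
  also have "\<dots> = c * lin_eval \<phi> s"
    unfolding lin_eval_def sum_distrib_left
    by (rule sum.cong) (auto simp: map.rep_eq when_def in_keys_iff)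
  finally show ?thesis .
qed

lemma lin_eval_lin_ext [simp]: "lin_eval \<phi> (lin_ext f s) = lin_eval (\<lambda>k. lin_eval \<phi> (f k)) s"
  by (simp add: lin_ext_def) (simp add: lin_eval_def)

lemma poly_mapping_eq_sum_single:
  "(f :: 'k \<Rightarrow>\<^sub>0 complex) = (\<Sum>k\<in>Poly_Mapping.keys f. Poly_Mapping.single k (Poly_Mapping.lookup f k))"
  by (rule poly_mapping_eqI)
    (auto simp: lookup_sum lookup_single when_def in_keys_iff)

lemma poly_mapping_induct [case_names single plus]:
  fixes f :: "'k \<Rightarrow>\<^sub>0 complex"
  assumes single: "\<And>k c. P (Poly_Mapping.single k c)"
    and plus: "\<And>s t. P s \<Longrightarrow> P t \<Longrightarrow> P (s + t)"
  shows "P f"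
proof -
  have "P (\<Sum>k\<in>S. Poly_Mapping.single k (Poly_Mapping.lookup f k))" if "finite S" for S
    using that
  proof induction
    case empty
    \<comment> \<open>The zero combination is a single term with coefficient 0, so the induction
      needs no case for 0.\<close>
    show ?case using single[of undefined 0] by simp
  qed (auto intro: single plus)
  then show ?thesis
    by (subst poly_mapping_eq_sum_single) auto
qed

lemma lin_eval_mult:
  fixes x y :: "'k::monoid_add \<Rightarrow>\<^sub>0 complex"
  shows "lin_eval \<phi> (x * y) = lin_eval (\<lambda>u. lin_eval (\<lambda>v. \<phi> (u + v)) y) x"
proof (induction x rule: poly_mapping_induct)
  case (single k c)
  show ?case
  proof (induction y rule: poly_mapping_induct)
    case (single k' c')
    then show ?case by (simp add: mult_single)
  qed (simp add: distrib_left)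
qed (simp add: distrib_right)

lemma keys_lin_ext: "Poly_Mapping.keys (lin_ext f s) \<subseteq> (\<Union>k\<in>Poly_Mapping.keys s. Poly_Mapping.keys (f k))"
proof
  fix m assume "m \<in> Poly_Mapping.keys (lin_ext f s)"
  then have "(\<Sum>k\<in>Poly_Mapping.keys s.
      Poly_Mapping.lookup (Poly_Mapping.map ((*) (Poly_Mapping.lookup s k)) (f k)) m) \<noteq> 0"
    by (simp add: in_keys_iff lin_ext_def lookup_sum)
  then obtain k where "k \<in> Poly_Mapping.keys s"
    "Poly_Mapping.lookup (Poly_Mapping.map ((*) (Poly_Mapping.lookup s k)) (f k)) m \<noteq> 0"
    by (rule sum.not_neutral_contains_not_neutral)
  then show "m \<in> (\<Union>k\<in>Poly_Mapping.keys s. Poly_Mapping.keys (f k))"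
    by (auto simp: in_keys_iff map.rep_eq when_def split: if_splits)
qed

section \<open>Ideals of the free algebra\<close>

lemma free_ring_simps [simp]:
  "carrier free_ring = UNIV" "x \<otimes>\<^bsub>free_ring\<^esub> y = x * y" "x \<oplus>\<^bsub>free_ring\<^esub> y = x + y"
  "\<one>\<^bsub>free_ring\<^esub> = 1" "\<zero>\<^bsub>free_ring\<^esub> = 0"
  by (auto simp: free_ring_def)

lemma ring_free_ring: "ring free_ring"
  by (intro ringI abelian_groupI monoidI)
    (auto simp: algebra_simps intro: exI[of _ "- x" for x])

lemma a_inv_free_ring [simp]: "\<ominus>\<^bsub>free_ring\<^esub> x = - x"
proof -
  interpret ring free_ring by (rule ring_free_ring)
  show ?thesis by (rule minus_equality) auto
qed

lemma ideal_free_ringI: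
  assumes "0 \<in> K" "\<And>x y. x \<in> K \<Longrightarrow> y \<in> K \<Longrightarrow> x + y \<in> K"
    and "\<And>x. x \<in> K \<Longrightarrow> - x \<in> K"
    and "\<And>a x. a \<in> K \<Longrightarrow> x * a \<in> K" "\<And>a x. a \<in> K \<Longrightarrow> a * x \<in> K"
  shows "ideal K free_ring"
proof (rule idealI[OF ring_free_ring])
  interpret ring free_ring by (rule ring_free_ring)
  show "subgroup K (add_monoid free_ring)"
  proof (rule group.subgroupI[OF a_group])
    fix a assume "a \<in> K"
    have "inv\<^bsub>add_monoid free_ring\<^esub> a = - a"
      using a_inv_free_ring[of a] by (simp only: a_inv_def)
    with assms(3)[OF \<open>a \<in> K\<close>] show "inv\<^bsub>add_monoid free_ring\<^esub> a \<in> K" by simp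
  qed (use assms in auto)
qed (use assms in auto)

text \<open>The elements killed by all two-sided translates of \<open>\<phi>\<close> form a
  two-sided ideal. It contains \<open>S\<close> by hypothesis, and translating by the empty word
  gives the claim.\<close>

lemma lin_eval_genideal:
  assumes rel: "\<And>r p q. r \<in> S \<Longrightarrow> lin_eval (\<lambda>w. \<phi> (p + w + q)) r = 0"
    and f: "f \<in> genideal free_ring S"
  shows "lin_eval \<phi> f = 0"
proof -
  define K where "K = {f. \<forall>p q. lin_eval (\<lambda>w. \<phi> (p + w + q)) f = 0}"
  have "ideal K free_ring"
  proof (rule ideal_free_ringI)
    fix a x assume a: "a \<in> K"
    have *: "lin_eval (\<lambda>w. \<phi> (p + (u + w) + q)) a = 0" for u p q
      using a by (simp add: K_def add.assoc[symmetric])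
    show "x * a \<in> K"
      by (auto simp: K_def lin_eval_mult *)
    show "a * x \<in> K"
    proof -
      have "lin_eval (\<lambda>w. \<phi> (p + w + q)) (a * x) = 0" for p q
      proof (induction x rule: poly_mapping_induct)
        case (single k c)
        have "lin_eval (\<lambda>w. \<phi> (p + w + (k + q))) a = 0"
          using a by (simp add: K_def)
        then show ?case by (simp add: lin_eval_mult lin_eval_mult_left add.assoc)
      qed (simp add: distrib_left)
      then show ?thesis by (simp add: K_def)
    qed
  qed (auto simp: K_def)
  moreover have "S \<subseteq> K" using rel by (auto simp: K_def)
  ultimately have "f \<in> K" using f by (auto simp: genideal_def)
  then have "lin_eval (\<lambda>w. \<phi> (0 + w + 0)) f = 0" unfolding K_def by blast
  then show ?thesis by simp
qed

section \<open>The group of pure words\<close>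

text \<open>The pair \<open>(s, r)\<close> stands for \<open>x\<^sup>s v\<^sup>r\<close> in the group \<open>\<langle>x, v | v x = x v\<^sup>-\<^sup>1\<rangle>\<close>. The two letters of a given
  difference type are sent to \<open>x\<close> and \<open>x v\<^sup>-\<^sup>1\<close>; both have square \<open>x\<^sup>2\<close>, which is central.\<close>

definition sign_int :: "int \<Rightarrow> int" where
  "sign_int s = (if even s then 1 else - 1)"

definition kmult :: "int \<times> int \<Rightarrow> int \<times> int \<Rightarrow> int \<times> int" where
  "kmult g h = (fst g + fst h, sign_int (fst h) * snd g + snd h)"

definition kinv :: "int \<times> int \<Rightarrow> int \<times> int" where
  "kinv g = (- fst g, - sign_int (fst g) * snd g)"

lemma sign_int_simps [simp]:
  "sign_int 0 = 1" "sign_int (- s) = sign_int s" "sign_int (s + t) = sign_int s * sign_int t" "sign_int s * sign_int s = 1"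
  "sign_int (2 * s) = 1" "sign_int 1 = - 1" "sign_int s * (sign_int s * r) = r"
  by (auto simp: sign_int_def)

lemma kmult_assoc: "kmult (kmult g h) k = kmult g (kmult h k)"
  by (auto simp: kmult_def algebra_simps)

lemma kmult_one [simp]: "kmult (0, 0) g = g" "kmult g (0, 0) = g"
  by (auto simp: kmult_def)

lemma kmult_kinv [simp]: "kmult (kinv g) g = (0, 0)" "kmult g (kinv g) = (0, 0)"
  by (auto simp: kmult_def kinv_def)

definition letter_val :: "bit \<Rightarrow> int \<times> int" where
  "letter_val i = (1, if i = 0 then 0 else - 1)"

fun word_val :: "(bit \<times> bit) list \<Rightarrow> int \<times> int" where
  "word_val [] = (0, 0)"
| "word_val (x # l) = kmult (letter_val (fst x)) (word_val l)"

definition gval :: "words \<Rightarrow> int \<times> int" where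
  "gval w = word_val (letters w)"

definition pure :: "bit \<Rightarrow> words \<Rightarrow> bool" where
  "pure d w \<longleftrightarrow> (\<forall>x\<in>set (letters w). fst x + snd x = d)"

lemma letters_simps [simp]: "letters (u + v) = letters u @ letters v" "letters (0 :: 'a fmonoid) = []"
  by (auto simp: plus_fmonoid_def zero_fmonoid_def)

lemma word_val_append: "word_val (l @ m) = kmult (word_val l) (word_val m)"
  by (induction l) (auto simp: kmult_assoc)

lemma gval_simps [simp]: "gval 0 = (0, 0)" "gval (u + v) = kmult (gval u) (gval v)"
  by (auto simp: gval_def word_val_append)

lemma pure_simps [simp]: "pure d 0" "pure d (u + v) \<longleftrightarrow> pure d u \<and> pure d v"
  by (auto simp: pure_def)

text \<open>The automorphism induced by exchanging the two indices \<open>0\<close> and \<open>1\<close> in all letters, to the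
  power \<open>d\<close>.\<close>

definition bar :: "bit \<Rightarrow> int \<times> int \<Rightarrow> int \<times> int" where
  "bar d g = (if d = 0 then g else (fst g, - of_bool (odd (fst g)) - snd g))"

lemma bar_kmult: "bar d (kmult g h) = kmult (bar d g) (bar d h)"
  by (auto simp: bar_def kmult_def sign_int_def)

lemma bar_letter_val: "bar d (letter_val i) = letter_val (i + d)"
  by (cases "i = 0"; cases "d = 0") (auto simp: bar_def letter_val_def)

lemma bar_one [simp]: "bar d (0, 0) = (0, 0)"
  by (auto simp: bar_def)

lemma word_val_shift: "word_val (map (\<lambda>(i, j). (i + d, j)) l) = bar d (word_val l)"
proof (induction l)
  case (Cons x l)
  then show ?case
    by (cases x) (simp only: list.map prod.case word_val.simps fst_conv bar_kmult bar_letter_val)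
qed simp

lemma word_val_fst_cong: "map fst l = map fst m \<Longrightarrow> word_val l = word_val m"
proof (induction l arbitrary: m)
  case (Cons x l)
  then obtain y m' where "m = y # m'" "fst x = fst y" "map fst l = map fst m'"
    by (cases m) auto
  then show ?case using Cons.IH[of m'] by simp
qed simp

lemma bit_add_cancel: "(i :: bit) + (i + d) = d" "i + d + i = d" "i + d + j = e \<longleftrightarrow> i + j = d + e"
  by (cases "i = 0"; cases "d = 0"; cases "j = 0"; cases "e = 0"; auto)+

lemma bit_add_eq_iff: "(i :: bit) + k = d \<longleftrightarrow> k = i + d"
  by (cases "i = 0"; cases "d = 0"; cases "k = 0"; auto)

lemma bit_sum_two: "\<phi> 0 + \<phi> (1 :: bit) = \<phi> i + (\<phi> (i + 1) :: complex)"
  by (cases "i = 0") auto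

section \<open>Comultiplication and counit on words\<close>

abbreviation letter_comult :: "bit \<times> bit \<Rightarrow> (words \<times> words \<Rightarrow>\<^sub>0 complex)" where
  "letter_comult \<equiv> (\<lambda>(i, j).
       Poly_Mapping.single (FM [(i, 0)], FM [(0, j)]) 1
     + Poly_Mapping.single (FM [(i, 1)], FM [(1, j)]) 1)"

text \<open>Among the \<open>2\<^sup>k\<close> summands of the comultiplication of a word with \<open>k\<close> letters, at most one has
  prescribed difference types \<open>d\<close> and \<open>d'\<close> in its tensor factors.\<close>

lemma lin_eval_word_comult:
  assumes "\<And>u v. \<not> (pure d u \<and> pure d' v) \<Longrightarrow> \<Phi> (u, v) = 0"
  shows "lin_eval \<Phi> (prod_list (map letter_comult l)) =
    (if pure (d + d') (FM l)
     then \<Phi> (FM (map (\<lambda>(i, j). (i, i + d)) l), FM (map (\<lambda>(i, j). (i + d, j)) l)) else 0)"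
  using assms
proof (induction l arbitrary: \<Phi>)
  case Nil
  then show ?case
    by (simp add: pure_def zero_prod_def zero_fmonoid_def)
next
  case (Cons x l)
  obtain i j where x: "x = (i, j)" by (cases x)
  define \<Psi> where "\<Psi> = (\<lambda>k q. \<Phi> ((FM [(i, k)], FM [(k, j)]) + q))"
  have "lin_eval \<Phi> (prod_list (map letter_comult (x # l)))
      = lin_eval (\<Psi> 0) (prod_list (map letter_comult l)) + lin_eval (\<Psi> 1) (prod_list (map letter_comult l))"
    by (simp add: x lin_eval_mult \<Psi>_def)
  \<comment> \<open>Of the two middle indices for the first letter only \<open>i + d\<close> gives a
    left letter of type \<open>d\<close>; the sum is reordered so that this one comes first.\<close>
  also have "\<dots> = lin_eval (\<Psi> (i + d)) (prod_list (map letter_comult l))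
      + lin_eval (\<Psi> (i + d + 1)) (prod_list (map letter_comult l))"
    by (rule bit_sum_two)
  also have "lin_eval (\<Psi> (i + d + 1)) (prod_list (map letter_comult l)) = 0"
  proof -
    have "\<Psi> (i + d + 1) q = 0" for q
      unfolding \<Psi>_def by (cases q, simp only: add_Pair, rule Cons.prems)
        (simp add: pure_def bit_add_eq_iff plus_fmonoid_def,
         cases "i = 0"; cases "d = 0"; simp)
    then have "\<Psi> (i + d + 1) = (\<lambda>_. 0)" by blast
    then show ?thesis by simp
  qed
  also have "lin_eval (\<Psi> (i + d)) (prod_list (map letter_comult l)) =
    (if pure (d + d') (FM l)
     then \<Psi> (i + d) (FM (map (\<lambda>(i, j). (i, i + d)) l), FM (map (\<lambda>(i, j). (i + d, j)) l)) else 0)"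
  proof (rule Cons.IH)
    show "\<Psi> (i + d) (u, v) = 0" if "\<not> (pure d u \<and> pure d' v)" for u v
      unfolding \<Psi>_def add_Pair by (rule Cons.prems) (use that in simp)
  qed
  also have "\<dots> + 0 = (if pure (d + d') (FM (x # l))
     then \<Phi> (FM (map (\<lambda>(i, j). (i, i + d)) (x # l)), FM (map (\<lambda>(i, j). (i + d, j)) (x # l))) else 0)"
  proof (cases "i + j = d + d'")
    case True
    then have "pure (d + d') (FM (x # l)) = pure (d + d') (FM l)"
      by (simp add: pure_def x del: add_bit_eq_xor)
    then show ?thesis by (simp add: \<Psi>_def x plus_fmonoid_def del: add_bit_eq_xor)
  next
    case False
    then have "\<not> pure (d + d') (FM (x # l))"
      by (simp add: pure_def x del: add_bit_eq_xor)
    moreover have "\<Psi> (i + d) (u, v) = 0" for u v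
      unfolding \<Psi>_def add_Pair
      by (rule Cons.prems) (use False in \<open>simp add: pure_def bit_add_cancel del: add_bit_eq_xor\<close>)
    ultimately show ?thesis by simp
  qed
  finally show ?case .
qed

lemma lin_eval_free_comult:
  "lin_eval \<Phi> (free_comult f) = lin_eval (\<lambda>w. lin_eval \<Phi> (prod_list (map letter_comult (letters w)))) f"
  by (simp add: free_comult_def)

text \<open>The surviving left factor has the same first indices as the word, hence the same value
  in the group. Those of the right factor are shifted by \<open>d\<close>, which acts on the value
  as \<open>bar d\<close>.\<close>

lemma lin_eval_free_comult_pure:
  "lin_eval (\<lambda>(u, v). if pure d u \<and> pure d' v then F (gval u) (gval v) else 0) (free_comult f)
   = lin_eval (\<lambda>w. if pure (d + d') w then F (gval w) (bar d (gval w)) else 0) f"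
proof -
  have *: "pure d (FM (map (\<lambda>(i, j). (i, i + d)) l))" for l
    by (auto simp: pure_def bit_add_cancel simp del: add_bit_eq_xor)
  have **: "pure d' (FM (map (\<lambda>(i, j). (i + d, j)) l))" if "pure (d + d') (FM l)" for l
    using that by (auto simp: pure_def bit_add_cancel simp del: add_bit_eq_xor)
  have 1: "word_val (map (\<lambda>(i, j). (i, i + d)) l) = word_val l" for l
    by (rule word_val_fst_cong) auto
  show ?thesis unfolding lin_eval_free_comult
  proof (rule lin_eval_cong, subst lin_eval_word_comult[where d = d and d' = d'], goal_cases)
    case (2 w)
    then show ?case
      by (cases w) (simp add: * ** 1 word_val_shift gval_def del: add_bit_eq_xor)
  qed auto
qed

lemma lin_eval_free_counit: "free_counit f = lin_eval (\<lambda>w. if pure 0 w then 1 else 0) f"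
proof -
  have "prod_list (map (\<lambda>(i, j). of_bool (i = j)) l) = (if pure 0 (FM l) then 1 else 0 :: complex)" for l
  proof (induction l)
    case (Cons x l)
    obtain i j where x: "x = (i, j)" by (cases x)
    have "pure 0 (FM (x # l)) \<longleftrightarrow> i = j \<and> pure 0 (FM l)"
      by (cases "i = 0"; cases "j = 0") (simp_all add: pure_def x)
    then show ?case using Cons by (simp add: x)
  qed (simp add: pure_def)
  then have "prod_list (map (\<lambda>(i, j). of_bool (i = j)) (letters w)) = (if pure 0 w then 1 else 0 :: complex)" for w
    by (cases w) auto
  then show ?thesis by (simp add: free_counit_def lin_eval_def)
qed

section \<open>Functionals on the quotient\<close>

fun alt_word :: "nat \<Rightarrow> 'a \<Rightarrow> 'a \<Rightarrow> 'a list" where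
  "alt_word 0 x y = []"
| "alt_word (Suc n) x y = x # alt_word n y x"

lemma gen_power: "gen i j ^ k = Poly_Mapping.single (FM (replicate k (i, j))) 1"
proof (induction k)
  case 0
  then show ?case by (simp flip: zero_fmonoid_def)
qed (simp add: gen_def mult_single plus_fmonoid_def)

lemma alt_gen: "alt n (gen i j) (gen k l) = Poly_Mapping.single (FM (alt_word n (i, j) (k, l))) 1"
proof (induction n arbitrary: i j k l)
  case 0
  then show ?case by (simp flip: zero_fmonoid_def)
qed (simp add: gen_def mult_single plus_fmonoid_def)

text \<open>Removing the first letter exchanges the two alternating words, which gives the
  induction. For \<open>n = L\<close> they differ by v^L up to inversion, so the alternating
  relation is a condition on v^L only.\<close>

lemma word_val_alt_word:
  "\<exists>r. word_val (alt_word n (0, j) (1, l)) = (int n, r) \<and>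
       word_val (alt_word n (1, l) (0, j)) = (int n, r + sign_int (int n) * int n)"
proof (induction n arbitrary: j l)
  case (Suc n)
  obtain r where r: "word_val (alt_word n (0, j) (1, l)) = (int n, r)"
    "word_val (alt_word n (1, l) (0, j)) = (int n, r + sign_int (int n) * int n)"
    using Suc by blast
  show ?case
    by (rule exI[of _ "r + sign_int (int n) * int n"])
      (simp add: r letter_val_def kmult_def algebra_simps)
qed simp

lemma word_val_replicate: "word_val (replicate k (0, j)) = (int k, 0)"
  by (induction k) (auto simp: letter_val_def kmult_def)

text \<open>\<open>c\<^sup>k\<close> for \<open>c = \<plusminus>1\<close>.\<close>

definition sign_pow :: "complex \<Rightarrow> int \<Rightarrow> complex" where
  "sign_pow c k = (if even k then 1 else c)"

lemma set_alt_word: "set (alt_word n x y) \<subseteq> {x, y}"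
  by (induction n x y rule: alt_word.induct) auto

section \<open>Quasi-periodic functions and the ideal of relations\<close>

locale suzuki =
  fixes N L :: nat and \<alpha> \<beta> :: complex
  assumes N_pos: "N \<ge> 1" and L_ge: "L \<ge> 2"
    and alpha: "\<alpha> \<in> {1, - 1}" and beta: "\<beta> \<in> {1, - 1}"
begin

text \<open>\<open>wt d\<close> and \<open>vt d\<close> are the values of x^(2N) and v^L in the
  factor of type \<open>d\<close>.\<close>

definition wt :: "bit \<Rightarrow> complex" where "wt d = (if d = 0 then 1 else \<alpha>)"
definition vt :: "bit \<Rightarrow> complex" where "vt d = (if d = 0 then 1 else \<beta>)"

lemma wt_vt_square [simp]: "wt d * wt d = 1" "vt d * vt d = 1"
  "wt d * (wt d * x) = x" "vt d * (vt d * x) = x"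
  using alpha beta by (auto simp: wt_def vt_def)

lemma wt_vt_add: "wt (d + e) = wt d * wt e" "vt (d + e) = vt d * vt e"
  using alpha beta by (cases "d = 0"; cases "e = 0"; auto simp: wt_def vt_def)+

lemma sign_pow_wt_vt [simp]: "sign_pow (wt d) (j + k) = sign_pow (wt d) j * sign_pow (wt d) k"
  "sign_pow (vt d) (j + k) = sign_pow (vt d) j * sign_pow (vt d) k"
  by (auto simp: sign_pow_def)

text \<open>These are the functions on the group that descend to linear functionals on the twisted
  group algebra with x^(2N) = \<open>wt t\<close> and v^L = \<open>vt t\<close>.\<close>

definition quasi_periodic :: "bit \<Rightarrow> (int \<times> int \<Rightarrow> complex) \<Rightarrow> bool" where
  "quasi_periodic t \<psi> \<longleftrightarrow> (\<forall>s r. \<psi> (s + 2 * int N, r) = wt t * \<psi> (s, r)) \<and>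
                          (\<forall>s r. \<psi> (s, r + int L) = vt t * \<psi> (s, r))"

lemma quasi_periodic_int:
  assumes "quasi_periodic t \<psi>"
  shows "\<psi> (s + 2 * int N * j, r + int L * k) = sign_pow (wt t) j * sign_pow (vt t) k * \<psi> (s, r)"
proof -
  have 1: "\<psi> (s + 2 * int N * j, r) = sign_pow (wt t) j * \<psi> (s, r)" for s r
  proof (induction j rule: int_induct[where k = 0])
    case (step1 i)
    have "\<psi> (s + 2 * int N * i + 2 * int N, r) = wt t * \<psi> (s + 2 * int N * i, r)"
      using assms by (auto simp: quasi_periodic_def)
    with step1 show ?case by (auto simp: algebra_simps sign_pow_def)
  next
    case (step2 i)
    have "\<psi> (s + 2 * int N * (i - 1) + 2 * int N, r) = wt t * \<psi> (s + 2 * int N * (i - 1), r)"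
      using assms by (auto simp: quasi_periodic_def)
    then have "\<psi> (s + 2 * int N * (i - 1), r) = wt t * \<psi> (s + 2 * int N * i, r)"
      by (simp add: algebra_simps)
    with step2 show ?case by (auto simp: sign_pow_def)
  qed (auto simp: sign_pow_def)
  have 2: "\<psi> (s, r + int L * k) = sign_pow (vt t) k * \<psi> (s, r)" for s r
  proof (induction k rule: int_induct[where k = 0])
    case (step1 i)
    have "\<psi> (s, r + int L * i + int L) = vt t * \<psi> (s, r + int L * i)"
      using assms by (auto simp: quasi_periodic_def)
    with step1 show ?case by (auto simp: algebra_simps sign_pow_def)
  next
    case (step2 i)
    have "\<psi> (s, r + int L * (i - 1) + int L) = vt t * \<psi> (s, r + int L * (i - 1))"
      using assms by (auto simp: quasi_periodic_def)
    then have "\<psi> (s, r + int L * (i - 1)) = vt t * \<psi> (s, r + int L * i)"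
      by (simp add: algebra_simps)
    with step2 show ?case by (auto simp: sign_pow_def)
  qed (auto simp: sign_pow_def)
  show ?thesis by (simp add: 1 2)
qed

text \<open>Even powers of x are central, and v^(Lk) can at most be inverted on its way past
  \<open>h\<close>. Since the multipliers are signs, only the parity of \<open>k\<close> counts and
  the inversion is invisible.\<close>

lemma quasi_periodic_kmult:
  assumes "quasi_periodic t \<psi>"
  shows "\<psi> (kmult g (kmult (s + 2 * int N * j, r + int L * k) h))
       = sign_pow (wt t) j * sign_pow (vt t) k * \<psi> (kmult g (kmult (s, r) h))"
proof -
  have "kmult g (kmult (s + 2 * int N * j, r + int L * k) h)
      = (fst (kmult g (kmult (s, r) h)) + 2 * int N * j,
         snd (kmult g (kmult (s, r) h)) + int L * (sign_int (fst h) * k))"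
    by (simp add: kmult_def mult.assoc) (simp add: algebra_simps)
  then have "\<psi> (kmult g (kmult (s + 2 * int N * j, r + int L * k) h))
      = sign_pow (wt t) j * sign_pow (vt t) (sign_int (fst h) * k) * \<psi> (kmult g (kmult (s, r) h))"
    by (simp add: quasi_periodic_int[OF assms])
  then show ?thesis by (simp add: sign_pow_def sign_int_def)
qed

abbreviation "ker \<equiv> suzuki_ideal N L \<alpha> \<beta>"

definition pure_eval :: "bit \<Rightarrow> (int \<times> int \<Rightarrow> complex) \<Rightarrow> words \<Rightarrow> complex" where
  "pure_eval t \<psi> w = (if pure t w then \<psi> (gval w) else 0)"

text \<open>By \<open>lin_eval_genideal\<close> it is enough to test translates against each
  defining relation. Mixed products vanish because they are not pure; the other relations hold in
  the group up to the multipliers.\<close>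

lemma quasi_periodic_ker:
  assumes \<psi>: "quasi_periodic t \<psi>" and f: "f \<in> ker"
  shows "lin_eval (pure_eval t \<psi>) f = 0"
proof (rule lin_eval_genideal[OF _ f[unfolded suzuki_ideal_def]])
  fix r p q
  let ?\<phi> = "\<lambda>w. pure_eval t \<psi> (p + w + q)"
  have \<phi>: "?\<phi> w = (if pure t p \<and> pure t w \<and> pure t q
      then \<psi> (kmult (gval p) (kmult (gval w) (gval q))) else 0)" for w
    by (auto simp: pure_eval_def kmult_assoc)
  have alt_pure: "pure t (FM (alt_word L (0, d) (1, 1 + d))) \<longleftrightarrow> t = d"
     "pure t (FM (alt_word L (1, 1 + d) (0, d))) \<longleftrightarrow> t = d" for d
    using set_alt_word[of L "(0, d)" "(1, 1 + d)"] set_alt_word[of L "(1, 1 + d)" "(0, d)"] L_ge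
    by (cases L; cases "d = 0"; cases "t = 0"; auto simp: pure_def)+
  have alt_rel: "?\<phi> (FM (alt_word L (0, d) (1, 1 + d)))
      = vt d * ?\<phi> (FM (alt_word L (1, 1 + d) (0, d)))" for d
  proof -
    obtain r where r: "word_val (alt_word L (0, d) (1, 1 + d)) = (int L, r)"
       "word_val (alt_word L (1, 1 + d) (0, d)) = (int L, r + sign_int (int L) * int L)"
      using word_val_alt_word by blast
    have *: "sign_int (int L) * int L = int L * sign_int (int L)" by simp
    show ?thesis unfolding \<phi> alt_pure gval_def fmonoid.sel r *
      using quasi_periodic_kmult[OF \<psi>, of "word_val (letters p)" "int L" 0 r "sign_int (int L)"]
      by (auto simp: sign_pow_def sign_int_def split: if_splits)
  qed
  assume "r \<in> suzuki_relations N L \<alpha> \<beta>"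
  then consider "r = gen 0 0 ^ 2 - gen 1 1 ^ 2" | "r = gen 0 1 ^ 2 - gen 1 0 ^ 2"
    | "r = gen 0 0 ^ (2 * N) + scalar \<alpha> * gen 0 1 ^ (2 * N) - 1"
    | "r = alt L (gen 0 0) (gen 1 1) - alt L (gen 1 1) (gen 0 0)"
    | "r = alt L (gen 0 1) (gen 1 0) - scalar \<beta> * alt L (gen 1 0) (gen 0 1)"
    | i j k l where "r = gen i j * gen k l" "i - j \<noteq> k - l"
    unfolding suzuki_relations_def by blast
  then show "lin_eval ?\<phi> r = 0"
  proof cases
    case 1
    have "?\<phi> (FM (replicate 2 (0, 0))) = ?\<phi> (FM (replicate 2 (1, 1)))"
      by (simp add: \<phi> pure_def gval_def numeral_2_eq_2 letter_val_def kmult_def)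
    then show ?thesis by (simp add: 1 gen_power)
  next
    case 2
    have "?\<phi> (FM (replicate 2 (0, 1))) = ?\<phi> (FM (replicate 2 (1, 0)))"
      by (simp add: \<phi> pure_def gval_def numeral_2_eq_2 letter_val_def kmult_def)
    then show ?thesis by (simp add: 2 gen_power)
  next
    case 3
    \<comment> \<open>Only the power whose letter has type \<open>t\<close> survives. Its multiplier
      is cancelled by its coefficient 1 or \<open>\<alpha>\<close> in the relation, as
      \<open>\<alpha>\<close> squares to 1.\<close>
    have "?\<phi> (FM (replicate (2 * N) (0, d))) = (if t = d then wt d * ?\<phi> 0 else 0)" for d
    proof -
      have "pure t (FM (replicate (2 * N) (0, d))) \<longleftrightarrow> t = d"
        using N_pos by (auto simp: pure_def)
      moreover have "gval (FM (replicate (2 * N) (0, d))) = (2 * int N, 0)"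
        by (simp add: gval_def word_val_replicate)
      moreover have "\<psi> (kmult g (kmult (2 * int N, 0) h)) = wt t * \<psi> (kmult g (kmult (0, 0) h))" for g h
        using quasi_periodic_kmult[OF \<psi>, of g 0 1 0 0 h] by (simp add: sign_pow_def)
      ultimately show ?thesis unfolding \<phi> by simp
    qed
    note this[of 0] this[of 1]
    then show ?thesis using alpha
      by (cases "t = 0") (auto simp: 3 gen_power scalar_def mult_single wt_def)
  next
    case 4
    then show ?thesis using alt_rel[of 0] by (simp add: alt_gen vt_def)
  next
    case 5
    then show ?thesis using alt_rel[of 1] by (simp add: alt_gen vt_def scalar_def mult_single)
  next
    case 6
    then have "\<not> pure t (FM [(i, j), (k, l)])"
      by (auto simp: pure_def)
    then have "?\<phi> (FM [(i, j), (k, l)]) = 0" unfolding \<phi> by simp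
    moreover have "r = Poly_Mapping.single (FM [(i, j), (k, l)]) 1"
      by (simp add: 6 gen_def mult_single plus_fmonoid_def)
    ultimately show ?thesis by simp
  qed
qed

end

section \<open>Normal forms\<close>

lemma scalar_simps: "scalar c * scalar d = scalar (c * d)" "scalar 1 = 1" "scalar 0 = 0"
  "scalar (c + d) = scalar c + scalar d"
  by (simp_all add: scalar_def mult_single single_add)

lemma scalar_commute: "f * scalar c = scalar c * f"
  by (induction f rule: poly_mapping_induct)
    (simp_all add: scalar_def mult_single distrib_left distrib_right mult.commute)

lemma scalar_mult_left: "f * (scalar c * g) = scalar c * (f * g)"
  by (simp only: mult.assoc[symmetric] scalar_commute)

lemma scalar_scalar_mult: "scalar c * (scalar d * g) = scalar (c * d) * g"
  by (simp only: mult.assoc[symmetric] scalar_simps)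

lemma power_double_Suc: "(x :: free_alg) ^ (2 * Suc j) = x ^ (2 * j) * (x * x)"
proof -
  have "2 * Suc j = 2 * j + 2" by simp
  then show ?thesis by (simp only: power_add power2_eq_square)
qed

lemma lin_eval_scalar_mult [simp]: "lin_eval \<phi> (scalar c * f) = c * lin_eval \<phi> f"
  by (simp add: scalar_def lin_eval_mult lin_eval_mult_left)

lemma single_eq_scalar_mult: "Poly_Mapping.single w c = scalar c * Poly_Mapping.single w 1"
  by (simp add: scalar_def mult_single)

lemma sum_bit: "(\<Sum>d\<in>UNIV. F (d :: bit)) = F 0 + (F 1 :: 'a :: comm_monoid_add)"
proof -
  have "sum F UNIV = sum F {0, 1}" by (rule sum.cong) auto
  then show ?thesis by simp
qed

text \<open>The reversal of \<open>alt\<close>: here \<open>x\<close> comes last. An alternating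
  product times its own reversal collapses from the middle; times the reversal with exchanged
  letters it continues the alternation.\<close>

fun ralt :: "nat \<Rightarrow> free_alg \<Rightarrow> free_alg \<Rightarrow> free_alg" where
  "ralt 0 x y = 1"
| "ralt (Suc n) x y = ralt n y x * x"

lemma alt_ralt_swap: "alt n x y * ralt n y x = (x * y) ^ n"
proof (induction n arbitrary: x y)
  case (Suc n)
  have "alt (Suc n) x y * ralt (Suc n) y x = x * (alt n y x * ralt n x y) * y"
    by (simp add: mult.assoc)
  also have "\<dots> = x * (y * x) ^ n * y" by (simp only: Suc)
  also have "\<dots> = (x * y) ^ Suc n"
    by (induction n) (simp_all add: mult.assoc power_commutes)
  finally show ?case .
qed simp

context suzuki
begin

lemma ideal_ker: "ideal ker free_ring"
  unfolding suzuki_ideal_def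
  by (rule ring.genideal_ideal[OF ring_free_ring]) simp

lemma relation_in_ker: "r \<in> suzuki_relations N L \<alpha> \<beta> \<Longrightarrow> r \<in> ker"
  unfolding suzuki_ideal_def
  using ring.genideal_self[OF ring_free_ring, of "suzuki_relations N L \<alpha> \<beta>"]
  by (simp add: subset_iff)

lemma ker_closed:
  shows zero_in_ker: "0 \<in> ker"
    and add_in_ker: "f \<in> ker \<Longrightarrow> g \<in> ker \<Longrightarrow> f + g \<in> ker"
    and uminus_in_ker: "f \<in> ker \<Longrightarrow> - f \<in> ker"
    and mult_left_in_ker: "f \<in> ker \<Longrightarrow> h * f \<in> ker"
    and mult_right_in_ker: "f \<in> ker \<Longrightarrow> f * h \<in> ker"
proof -
  interpret ideal ker free_ring by (rule ideal_ker)
  show "0 \<in> ker" using additive_subgroup.zero_closed[OF is_additive_subgroup] by simp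
  show "f \<in> ker \<Longrightarrow> g \<in> ker \<Longrightarrow> f + g \<in> ker" for f g
    using additive_subgroup.a_closed[OF is_additive_subgroup, of f g] by simp
  show "f \<in> ker \<Longrightarrow> - f \<in> ker" for f
    using I_r_closed[of f "- 1"] by simp
  show "f \<in> ker \<Longrightarrow> h * f \<in> ker" using I_l_closed[of f h] by simp
  show "f \<in> ker \<Longrightarrow> f * h \<in> ker" using I_r_closed[of f h] by simp
qed

section \<open>Congruence modulo the relations, exact and up to sign\<close>

definition eqv :: "free_alg \<Rightarrow> free_alg \<Rightarrow> bool" (infix \<open>\<approx>\<close> 50) where
  "f \<approx> g \<longleftrightarrow> f - g \<in> ker"

lemma eqv_refl [simp]: "f \<approx> f"
  by (simp add: eqv_def ker_closed)

lemma eqv_sym: "f \<approx> g \<Longrightarrow> g \<approx> f"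
  using uminus_in_ker[of "f - g"] by (simp add: eqv_def)

lemma eqv_trans [trans]: "f \<approx> g \<Longrightarrow> g \<approx> h \<Longrightarrow> f \<approx> h"
  using add_in_ker[of "f - g" "g - h"] by (simp add: eqv_def)

lemma eqv_add: "f \<approx> f' \<Longrightarrow> g \<approx> g' \<Longrightarrow> f + g \<approx> f' + g'"
  using add_in_ker[of "f - f'" "g - g'"] by (simp add: eqv_def algebra_simps)

lemma eqv_mult: assumes "f \<approx> f'" "g \<approx> g'" shows "f * g \<approx> f' * g'"
proof -
  have "(f - f') * g + f' * (g - g') \<in> ker"
    using assms by (intro add_in_ker mult_left_in_ker mult_right_in_ker) (auto simp: eqv_def)
  then show ?thesis by (simp add: eqv_def algebra_simps)
qed

text \<open>Signs do not affect which words span the quotient, so rewriting up to sign avoids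
  tracking the factors \<open>\<alpha>\<close> and \<open>\<beta>\<close>.\<close>

definition sim :: "free_alg \<Rightarrow> free_alg \<Rightarrow> bool" (infix \<open>\<sim>\<close> 50) where
  "f \<sim> g \<longleftrightarrow> f \<approx> g \<or> f \<approx> scalar (- 1) * g"

lemma sim_iff: "f \<sim> g \<longleftrightarrow> (\<exists>c. (c = 1 \<or> c = - 1) \<and> f \<approx> scalar c * g)"
  by (auto simp: sim_def scalar_simps)

lemma eqv_sim: "f \<approx> g \<Longrightarrow> f \<sim> g"
  by (simp add: sim_def)

lemma sim_refl [simp]: "f \<sim> f"
  by (simp add: sim_def)

lemma sim_mult: assumes "f \<sim> f'" "g \<sim> g'" shows "f * g \<sim> f' * g'"
proof -
  obtain c d where c: "c = 1 \<or> c = - 1" "f \<approx> scalar c * f'" and d: "d = 1 \<or> d = - 1" "g \<approx> scalar d * g'"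
    using assms by (auto simp: sim_iff)
  have "f * g \<approx> scalar c * f' * (scalar d * g')"
    by (rule eqv_mult) fact+
  also have "scalar c * f' * (scalar d * g') = scalar (c * d) * (f' * g')"
    by (simp only: mult.assoc scalar_mult_left[of f'] scalar_scalar_mult)
  finally show ?thesis using c d by (auto simp: sim_iff)
qed

lemma sim_trans [trans]: assumes "f \<sim> g" "g \<sim> h" shows "f \<sim> h"
proof -
  obtain c d where c: "c = 1 \<or> c = - 1" "f \<approx> scalar c * g" and d: "d = 1 \<or> d = - 1" "g \<approx> scalar d * h"
    using assms by (auto simp: sim_iff)
  have "f \<approx> scalar c * g" by fact
  also have "\<dots> \<approx> scalar c * (scalar d * h)" by (intro eqv_mult eqv_refl d)
  also have "\<dots> = scalar (c * d) * h" by (simp add: mult.assoc[symmetric] scalar_simps)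
  finally show ?thesis using c d by (auto simp: sim_iff)
qed

lemma sim_sym: assumes "f \<sim> g" shows "g \<sim> f"
proof -
  obtain c where c: "c = 1 \<or> c = - 1" "f \<approx> scalar c * g"
    using assms by (auto simp: sim_iff)
  have "scalar c * f \<approx> scalar c * (scalar c * g)" by (intro eqv_mult eqv_refl c)
  also have "\<dots> = g" using c by (auto simp: mult.assoc[symmetric] scalar_simps)
  finally show ?thesis using c by (auto simp: sim_iff intro: eqv_sym)
qed

lemma sim_power: "f \<sim> g \<Longrightarrow> f ^ n \<sim> g ^ n"
  by (induction n) (auto intro: sim_mult)

lemma sim_mult_left: "f \<sim> g \<Longrightarrow> h * f \<sim> h * g"
  and sim_mult_right: "f \<sim> g \<Longrightarrow> f * h \<sim> g * h"
  by (auto intro: sim_mult)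

section \<open>Rewriting to normal words\<close>

definition ga :: "bit \<Rightarrow> free_alg" where "ga d = gen 0 d"
text \<open>The second index \<open>1 + d\<close> makes this the other letter of type
  \<open>d\<close>. In the group \<open>ga d\<close> is x and \<open>gb d\<close> is x v^-1.\<close>

definition gb :: "bit \<Rightarrow> free_alg" where "gb d = gen 1 (1 + d)"

lemma gen_mixed: "i + j \<noteq> k + l \<Longrightarrow> gen i j * gen k l \<approx> 0"
proof -
  assume "i + j \<noteq> k + l"
  then have "i - j \<noteq> k - l" by simp
  then have "gen i j * gen k l \<in> suzuki_relations N L \<alpha> \<beta>"
    unfolding suzuki_relations_def by blast
  then show ?thesis by (simp add: eqv_def relation_in_ker)
qed

lemma gb_square: "gb d * gb d \<sim> ga d * ga d"
proof -
  have "ga d ^ 2 - gb d ^ 2 \<in> ker"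
    by (rule relation_in_ker) (cases "d = 0"; simp add: suzuki_relations_def ga_def gb_def)
  then show ?thesis by (intro sim_sym[OF eqv_sim]) (simp add: eqv_def power2_eq_square)
qed

lemma alt_sim: "alt L (gb d) (ga d) \<sim> alt L (ga d) (gb d)"
proof -
  have "alt L (ga d) (gb d) - scalar (vt d) * alt L (gb d) (ga d) \<in> ker"
    by (rule relation_in_ker) (cases "d = 0"; simp add: suzuki_relations_def ga_def gb_def vt_def scalar_simps)
  then have "alt L (ga d) (gb d) \<sim> alt L (gb d) (ga d)"
    using beta unfolding sim_iff eqv_def by (intro exI[of _ "vt d"]) (auto simp: vt_def)
  then show ?thesis by (rule sim_sym)
qed

lemma one_eqv: "1 \<approx> ga 0 ^ (2 * N) + scalar \<alpha> * ga 1 ^ (2 * N)"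
proof -
  have "ga 0 ^ (2 * N) + scalar \<alpha> * ga 1 ^ (2 * N) - 1 \<in> ker"
    by (rule relation_in_ker) (simp add: suzuki_relations_def ga_def)
  then show ?thesis by (intro eqv_sym[of _ 1]) (simp add: eqv_def)
qed

text \<open>Multiplying the relation for 1 by \<open>ga d\<close> kills the power of the other type.
  The extra factor \<open>ga d\<close> is there because \<open>ga d ^ (2 * N)\<close> acts as a
  scalar only inside the factor of type \<open>d\<close>.\<close>

lemma ga_period: "ga d * ga d ^ (2 * N) \<sim> ga d"
proof -
  have mixed: "ga d * ga e ^ (2 * N) \<approx> 0" if "d \<noteq> e" for e
  proof -
    have "ga d * ga e \<approx> 0" unfolding ga_def by (rule gen_mixed) (use that in auto)
    then have "ga d * ga e * ga e ^ (2 * N - 1) \<approx> 0 * ga e ^ (2 * N - 1)"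
      by (intro eqv_mult) auto
    moreover have "ga d * ga e * ga e ^ (2 * N - 1) = ga d * ga e ^ (2 * N)"
      using N_pos by (simp add: mult.assoc flip: power_Suc)
    ultimately show ?thesis by simp
  qed
  have "ga d * 1 \<approx> ga d * (ga 0 ^ (2 * N) + scalar \<alpha> * ga 1 ^ (2 * N))"
    by (intro eqv_mult one_eqv) auto
  also have "\<dots> = ga d * ga 0 ^ (2 * N) + scalar \<alpha> * (ga d * ga 1 ^ (2 * N))"
    by (simp only: distrib_left scalar_mult_left)
  also have "\<dots> \<approx> scalar (wt d) * (ga d * ga d ^ (2 * N))"
  proof (cases "d = 0")
    case True
    have "ga d * ga 0 ^ (2 * N) + scalar \<alpha> * (ga d * ga 1 ^ (2 * N)) \<approx> ga d * ga 0 ^ (2 * N) + scalar \<alpha> * 0"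
      by (intro eqv_add eqv_mult mixed) (auto simp: True)
    then show ?thesis by (simp add: True wt_def scalar_simps)
  next
    case False
    then have "ga d * ga 0 ^ (2 * N) + scalar \<alpha> * (ga d * ga 1 ^ (2 * N)) \<approx> 0 + scalar \<alpha> * (ga d * ga 1 ^ (2 * N))"
      by (intro eqv_add mixed) auto
    then show ?thesis using False by (simp add: wt_def)
  qed
  finally have "ga d \<approx> scalar (wt d) * (ga d * ga d ^ (2 * N))" by simp
  then have "ga d \<sim> ga d * ga d ^ (2 * N)"
    using alpha unfolding sim_iff by (intro exI[of _ "wt d"]) (auto simp: wt_def)
  then show ?thesis by (rule sim_sym)
qed

lemma ga_power_period: "k \<ge> 1 \<Longrightarrow> ga d ^ (k + 2 * N * j) \<sim> ga d ^ k"
proof (induction j)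
  case (Suc j)
  have "ga d ^ (k + 2 * N * Suc j) = (ga d * ga d ^ (2 * N)) * ga d ^ (k - 1 + 2 * N * j)"
    using Suc.prems by (simp flip: power_add power_Suc add: algebra_simps)
  also have "\<dots> \<sim> ga d * ga d ^ (k - 1 + 2 * N * j)"
    by (intro sim_mult_right ga_period)
  also have "\<dots> = ga d ^ (k + 2 * N * j)"
    using Suc.prems by (simp flip: power_Suc)
  finally show ?case using Suc by (blast intro: sim_trans)
qed simp

text \<open>The squares of the two letters agree up to sign, so this square commutes with
  \<open>gb d\<close> as well.\<close>

lemma gb_ga_commute: "gb d * ga d ^ (2 * j) \<sim> ga d ^ (2 * j) * gb d"
proof (induction j)
  case (Suc j)
  have "gb d * ga d ^ (2 * Suc j) = (gb d * ga d ^ (2 * j)) * (ga d * ga d)"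
    by (simp only: power_double_Suc mult.assoc)
  also have "\<dots> \<sim> (ga d ^ (2 * j) * gb d) * (gb d * gb d)"
    by (rule sim_mult[OF Suc sim_sym[OF gb_square]])
  also have "\<dots> = ga d ^ (2 * j) * ((gb d * gb d) * gb d)"
    by (simp add: mult.assoc)
  also have "\<dots> \<sim> ga d ^ (2 * j) * ((ga d * ga d) * gb d)"
    by (rule sim_mult_left[OF sim_mult_right[OF gb_square]])
  also have "\<dots> = ga d ^ (2 * Suc j) * gb d"
    by (simp only: power_double_Suc mult.assoc)
  finally show ?case .
qed simp

text \<open>The product is a palindrome. By induction its inside is an even power of
  \<open>ga d\<close>, which moves past the outer \<open>x\<close> and leaves \<open>x * x\<close>,
  again the square of \<open>ga d\<close> up to sign.\<close>

lemma alt_ralt: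
  assumes "(x, y) = (ga d, gb d) \<or> (x, y) = (gb d, ga d)"
  shows "alt n x y * ralt n x y \<sim> ga d ^ (2 * n)"
  using assms
proof (induction n arbitrary: x y)
  case (Suc n)
  have "alt (Suc n) x y * ralt (Suc n) x y = x * (alt n y x * ralt n y x) * x"
    by (simp add: mult.assoc)
  also have "\<dots> \<sim> x * ga d ^ (2 * n) * x"
    by (intro sim_mult Suc.IH sim_refl) (use Suc.prems in auto)
  also have "\<dots> \<sim> ga d ^ (2 * n) * x * x"
    using Suc.prems by (intro sim_mult_right) (auto simp: gb_ga_commute power_commutes)
  also have "\<dots> = ga d ^ (2 * n) * (x * x)" by (simp add: mult.assoc)
  also have "\<dots> \<sim> ga d ^ (2 * n) * (ga d * ga d)"
    by (intro sim_mult_left) (use Suc.prems gb_square in auto)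
  also have "\<dots> = ga d ^ (2 * Suc n)"
    by (simp only: power_double_Suc)
  finally show ?case .
qed simp

text \<open>The power is an alternating word of length 2L. Exchanging the letters in its first half
  by the alternating relation turns it into a palindrome, which collapses.\<close>

lemma gb_ga_power: "(gb d * ga d) ^ L \<sim> ga d ^ (2 * L)"
proof -
  have "(gb d * ga d) ^ L = alt L (gb d) (ga d) * ralt L (ga d) (gb d)"
    by (simp add: alt_ralt_swap)
  also have "\<dots> \<sim> alt L (ga d) (gb d) * ralt L (ga d) (gb d)"
    by (intro sim_mult_right alt_sim)
  also have "\<dots> \<sim> ga d ^ (2 * L)" by (rule alt_ralt) simp
  finally show ?thesis .
qed

text \<open>The block \<open>gb d * ga d\<close> stands for x^2 v and is used in place of v to avoid
  inverses; the word stands for x^(s+2r) v^r.\<close>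

definition nword :: "bit \<Rightarrow> nat \<Rightarrow> nat \<Rightarrow> free_alg" where
  "nword d s r = ga d ^ s * (gb d * ga d) ^ r"

lemma nword_reduce:
  assumes "k \<ge> 1"
  shows "\<exists>s\<in>{1..2 * N}. \<exists>r<L. nword d k m \<sim> nword d s r"
proof -
  \<comment> \<open>Each of the \<open>m div L\<close> full groups of \<open>L\<close> blocks turns
    into \<open>2 * L\<close> letters \<open>ga d\<close>. The exponent is then reduced into 1..2N
    rather than 0..2N-1, since the period holds only while a letter remains.\<close>
  define k' where "k' = k + 2 * L * (m div L)"
  define s where "s = (k' - 1) mod (2 * N) + 1"
  have "nword d k m = ga d ^ k * (((gb d * ga d) ^ L) ^ (m div L) * (gb d * ga d) ^ (m mod L))"
    by (simp add: nword_def flip: power_add power_mult)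
  also have "\<dots> \<sim> ga d ^ k * ((ga d ^ (2 * L)) ^ (m div L) * (gb d * ga d) ^ (m mod L))"
    by (intro sim_mult sim_power gb_ga_power sim_refl)
  also have "\<dots> = ga d ^ k' * (gb d * ga d) ^ (m mod L)"
    by (simp add: k'_def power_add power_mult mult.assoc)
  also have "k' = s + 2 * N * ((k' - 1) div (2 * N))"
    using assms by (simp add: s_def k'_def)
  also have "ga d ^ (s + 2 * N * ((k' - 1) div (2 * N))) * (gb d * ga d) ^ (m mod L)
      \<sim> ga d ^ s * (gb d * ga d) ^ (m mod L)"
    by (intro sim_mult_right ga_power_period) (simp add: s_def)
  finally have "nword d k m \<sim> nword d s (m mod L)" by (simp only: nword_def)
  moreover have "s \<in> {1..2 * N}"
    using N_pos by (simp add: s_def Suc_le_eq)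
  ultimately show ?thesis using L_ge by (intro bexI exI conjI) auto
qed

lemma ga_nword: "ga d * nword d k m = nword d (Suc k) m"
  by (simp add: nword_def mult.assoc)

lemma gb_nword:
  assumes "k \<ge> 1"
  shows "\<exists>k'\<ge>1. \<exists>m'. gb d * nword d k m \<sim> nword d k' m'"
proof -
  \<comment> \<open>The exponent is raised by the period \<open>2 * N * (L + 1)\<close> and
    \<open>2 * L\<close> letters are traded for \<open>L\<close> blocks. Now there is a block whose
    \<open>gb d\<close> can absorb the new one if \<open>u\<close> is even, and if \<open>u\<close>
    is odd a positive exponent remains after one \<open>ga d\<close> is used to form a new
    block.\<close>
  define u where "u = k + 2 * (N - 1) * L + 2 * N"
  define v where "v = m + L"
  have u: "u \<ge> 2" using N_pos assms by (simp add: u_def)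
  have "nword d k m = ga d ^ k * (gb d * ga d) ^ m" by (simp add: nword_def)
  also have "\<dots> \<sim> ga d ^ (k + 2 * N * (L + 1)) * (gb d * ga d) ^ m"
    by (intro sim_mult_right sim_sym[OF ga_power_period] assms)
  also have "k + 2 * N * (L + 1) = u + 2 * L"
    using N_pos by (cases N) (auto simp: u_def algebra_simps)
  also have "ga d ^ (u + 2 * L) * (gb d * ga d) ^ m = ga d ^ u * (ga d ^ (2 * L) * (gb d * ga d) ^ m)"
    by (simp add: power_add mult.assoc)
  also have "\<dots> \<sim> ga d ^ u * ((gb d * ga d) ^ L * (gb d * ga d) ^ m)"
    by (intro sim_mult sim_refl sim_sym[OF gb_ga_power])
  also have "\<dots> = ga d ^ u * (gb d * ga d) ^ v"
    by (simp add: v_def power_add[symmetric] add.commute)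
  finally have *: "gb d * nword d k m \<sim> gb d * (ga d ^ u * (gb d * ga d) ^ v)"
    by (rule sim_mult_left)
  show ?thesis
  proof (cases "even u")
    case True
    then obtain j where j: "u = 2 * j" by blast
    obtain v' where v': "v = Suc v'" using L_ge by (cases v) (auto simp: v_def)
    have "gb d * (ga d ^ u * (gb d * ga d) ^ v) = (gb d * ga d ^ (2 * j)) * (gb d * ga d * (gb d * ga d) ^ v')"
      by (simp add: j v' mult.assoc)
    also have "\<dots> \<sim> (ga d ^ (2 * j) * gb d) * (gb d * ga d * (gb d * ga d) ^ v')"
      by (intro sim_mult_right gb_ga_commute)
    also have "\<dots> = ga d ^ (2 * j) * ((gb d * gb d) * (ga d * (gb d * ga d) ^ v'))"
      by (simp add: mult.assoc)
    also have "\<dots> \<sim> ga d ^ (2 * j) * ((ga d * ga d) * (ga d * (gb d * ga d) ^ v'))"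
      by (rule sim_mult_left[OF sim_mult_right[OF gb_square]])
    also have "\<dots> = nword d (2 * j + 3) v'"
      by (simp only: nword_def power_add power3_eq_cube mult.assoc)
    finally have "gb d * nword d k m \<sim> nword d (2 * j + 3) v'" using * by (blast intro: sim_trans)
    then show ?thesis by (intro exI[of _ "2 * j + 3"]) auto
  next
    case False
    then obtain j where j: "u = 2 * j + 1" using oddE by blast
    have "gb d * (ga d ^ u * (gb d * ga d) ^ v) = (gb d * ga d ^ (2 * j)) * (ga d * (gb d * ga d) ^ v)"
      by (simp only: j power_add power_one_right mult.assoc)
    also have "\<dots> \<sim> (ga d ^ (2 * j) * gb d) * (ga d * (gb d * ga d) ^ v)"
      by (intro sim_mult_right gb_ga_commute)
    also have "\<dots> = nword d (2 * j) (Suc v)"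
      by (simp add: nword_def mult.assoc)
    finally have "gb d * nword d k m \<sim> nword d (2 * j) (Suc v)" using * by (blast intro: sim_trans)
    then show ?thesis using u j by (intro exI[of _ "2 * j"]) auto
  qed
qed

text \<open>This makes the span of the normal words closed under left multiplication by letters. A
  letter of the wrong type is killed by the leading \<open>ga d\<close>, which is present because
  \<open>k \<ge> 1\<close>.\<close>

lemma gen_nword:
  assumes "k \<ge> 1"
  shows "gen i j * nword d k m \<approx> 0 \<or> (\<exists>s\<in>{1..2 * N}. \<exists>r<L. gen i j * nword d k m \<sim> nword d s r)"
proof (cases "i + j = d")
  case True
  then have "gen i j = (if i = 0 then ga d else gb d)"
    by (cases "i = 0"; cases "j = 0"; auto simp: ga_def gb_def)
  moreover have "\<exists>k'\<ge>1. \<exists>m'. gb d * nword d k m \<sim> nword d k' m'"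
    by (rule gb_nword[OF assms])
  moreover have "\<exists>k'\<ge>1. \<exists>m'. ga d * nword d k m \<sim> nword d k' m'"
    by (intro exI[of _ "Suc k"] conjI exI[of _ m]) (auto simp: ga_nword)
  ultimately obtain k' m' where "k' \<ge> 1" "gen i j * nword d k m \<sim> nword d k' m'"
    by (cases "i = 0") auto
  with nword_reduce[of k' d m'] show ?thesis by (blast intro: sim_trans)
next
  case False
  have "gen i j * ga d \<approx> 0" unfolding ga_def using False by (intro gen_mixed) auto
  then have "gen i j * ga d * (ga d ^ (k - 1) * (gb d * ga d) ^ m) \<approx> 0 * (ga d ^ (k - 1) * (gb d * ga d) ^ m)"
    by (intro eqv_mult) auto
  also have "gen i j * ga d * (ga d ^ (k - 1) * (gb d * ga d) ^ m) = gen i j * nword d k m"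
    using assms by (cases k) (auto simp: nword_def mult.assoc)
  finally show ?thesis by simp
qed

section \<open>The coefficient of the unit in the twisted group algebra, and the coordinates it
  defines\<close>

definition tau :: "bit \<Rightarrow> int \<times> int \<Rightarrow> complex" where
  "tau d g = (if 2 * int N dvd fst g \<and> int L dvd snd g
     then sign_pow (wt d) (fst g div (2 * int N)) * sign_pow (vt d) (snd g div int L) else 0)"

lemma tau_quasi_periodic: "quasi_periodic d (tau d)"
proof -
  have [simp]: "sign_pow c (k + 1) = c * sign_pow c k" if "c * c = 1" for c k
    using that by (auto simp: sign_pow_def)
  show ?thesis using N_pos L_ge by (auto simp: quasi_periodic_def tau_def sign_pow_def)
qed

text \<open>The trace property. If the x-exponents sum to an even number, they have the same parity:
  for even ones the v-exponents just add, and for odd ones the other order inverts the v-part, which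
  the signs do not see.\<close>

lemma tau_kmult_commute: "tau d (kmult g h) = tau d (kmult h g)"
proof (cases "2 * int N dvd fst g + fst h")
  case True
  then have "even (fst g + fst h)" by (meson dvd_mult_left)
  then have *: "sign_int (fst g) = sign_int (fst h)" by (auto simp: sign_int_def)
  show ?thesis
  proof (cases "even (fst h)")
    case True
    then show ?thesis using * by (simp add: tau_def kmult_def sign_int_def add.commute)
  next
    case False
    then have eq: "kmult h g = (fst (kmult g h), - snd (kmult g h))"
      using * by (simp add: kmult_def sign_int_def)
    have "sign_pow c (- x div int L) = sign_pow c (x div int L)" if "int L dvd x" for c x
      using that by (simp add: sign_pow_def dvd_neg_div)
    then show ?thesis unfolding eq by (simp add: tau_def)
  qed
next
  case False
  then show ?thesis by (simp add: tau_def kmult_def add.commute[of "fst h" "fst g"])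
qed

lemma quasi_periodic_left: "quasi_periodic t \<psi> \<Longrightarrow> quasi_periodic t (\<lambda>h. \<psi> (kmult g h))"
proof -
  assume \<psi>: "quasi_periodic t \<psi>"
  have "\<psi> (kmult g (s + 2 * int N, r)) = wt t * \<psi> (kmult g (s, r))" for s r
    using quasi_periodic_kmult[OF \<psi>, of g s 1 r 0 "(0, 0)"] by (simp add: sign_pow_def)
  moreover have "\<psi> (kmult g (s, r + int L)) = vt t * \<psi> (kmult g (s, r))" for s r
    using quasi_periodic_kmult[OF \<psi>, of g s 0 r 1 "(0, 0)"] by (simp add: sign_pow_def)
  ultimately show ?thesis by (simp add: quasi_periodic_def)
qed

text \<open>Up to sign, the coefficient of the inverse of \<open>g\<close> in the component of type
  \<open>d\<close>.\<close>

definition coef :: "bit \<Rightarrow> int \<times> int \<Rightarrow> free_alg \<Rightarrow> complex" where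
  "coef d g = lin_eval (pure_eval d (\<lambda>h. tau d (kmult g h)))"

lemma coef_ker: "f \<in> ker \<Longrightarrow> coef d g f = 0"
  unfolding coef_def by (rule quasi_periodic_ker[OF quasi_periodic_left[OF tau_quasi_periodic]])

lemma coef_cong: "f \<approx> f' \<Longrightarrow> coef d g f = coef d g f'"
  using coef_ker[of "f - f'" d g] by (simp add: eqv_def coef_def)

lemma coef_simps [simp]: "coef d g 0 = 0" "coef d g (f + f') = coef d g f + coef d g f'"
  "coef d g (f - f') = coef d g f - coef d g f'" "coef d g (scalar c * f) = c * coef d g f"
  "coef d g (sum F S) = (\<Sum>i\<in>S. coef d g (F i))"
  by (simp_all add: coef_def)

lemma coef_mult_left:
  "coef d g (f * h) = lin_eval (pure_eval d (\<lambda>u. coef d (kmult g u) h)) f"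
proof -
  have *: "pure_eval d (\<lambda>h. tau d (kmult g h)) (u + v) =
      (if pure d u then pure_eval d (\<lambda>h. tau d (kmult (kmult g (gval u)) h)) v else 0)" for u v
    by (auto simp: pure_eval_def kmult_assoc)
  show ?thesis unfolding coef_def lin_eval_mult *
    by (rule lin_eval_cong) (auto simp: pure_eval_def[abs_def])
qed

text \<open>The trace property of \<open>tau\<close> carries a right factor around to the left of
  \<open>g\<close>.\<close>

lemma coef_mult_right:
  "coef d g (f * h) = lin_eval (pure_eval d (\<lambda>u. coef d (kmult u g) f)) h"
proof (induction h rule: poly_mapping_induct)
  case (single w c)
  have *: "pure_eval d (\<lambda>h. tau d (kmult g h)) (u + w) =
      (if pure d w then pure_eval d (\<lambda>h. tau d (kmult (kmult (gval w) g) h)) u else 0)" for u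
    unfolding pure_eval_def gval_simps pure_simps kmult_assoc[symmetric]
    using tau_kmult_commute[of d "kmult g (gval u)" "gval w"] by (auto simp: kmult_assoc)
  show ?case unfolding coef_def lin_eval_mult lin_eval_single lin_eval_mult_left *
    by (auto simp: pure_eval_def[abs_def])
qed (simp_all add: distrib_left)

abbreviation nword_val :: "nat \<Rightarrow> nat \<Rightarrow> int \<times> int" where
  "nword_val s r \<equiv> (int s + 2 * int r, int r)"

text \<open>The empty word is pure of both types; it is the exceptional case, avoided later by
  requiring \<open>s \<ge> 1\<close>.\<close>

lemma nword_eq_single:
  "\<exists>w. nword d s r = Poly_Mapping.single w 1 \<and> gval w = nword_val s r \<and>
     (\<forall>e. pure e w \<longleftrightarrow> e = d \<or> (s = 0 \<and> r = 0))"
proof -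
  let ?w = "FM (replicate s (0, d) @ concat (replicate r [(1, 1 + d), (0, d)]))"
  have "(gb d * ga d) ^ r = Poly_Mapping.single (FM (concat (replicate r [(1, 1 + d), (0, d)]))) 1"
  proof (induction r)
    case 0
    then show ?case by (simp flip: zero_fmonoid_def)
  qed (simp add: gb_def ga_def gen_def mult_single plus_fmonoid_def)
  then have "nword d s r = Poly_Mapping.single ?w 1"
    by (simp add: nword_def ga_def gen_power mult_single plus_fmonoid_def)
  moreover have "word_val (concat (replicate r [(1, 1 + d), (0, d)])) = (2 * int r, int r)"
    by (induction r) (auto simp: letter_val_def kmult_def)
  then have "gval ?w = nword_val s r"
    by (simp add: gval_def word_val_append word_val_replicate kmult_def)
  moreover have "pure e ?w \<longleftrightarrow> e = d \<or> (s = 0 \<and> r = 0)" for e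
    by (cases "d = 0"; cases "e = 0"; auto simp: pure_def)
  ultimately show ?thesis by blast
qed

lemma lin_eval_nword:
  "s \<ge> 1 \<Longrightarrow> lin_eval (pure_eval e \<psi>) (nword d s r) = (if e = d then \<psi> (nword_val s r) else 0)"
proof -
  assume "s \<ge> 1"
  obtain w where "nword d s r = Poly_Mapping.single w 1" "gval w = nword_val s r"
    "\<forall>e. pure e w \<longleftrightarrow> e = d \<or> (s = 0 \<and> r = 0)"
    using nword_eq_single by blast
  with \<open>s \<ge> 1\<close> show ?thesis by (simp add: pure_eval_def)
qed

definition idx :: "(bit \<times> nat \<times> nat) set" where
  "idx = UNIV \<times> {1..2 * N} \<times> {..<L}"

lemma finite_idx [simp]: "finite idx"
proof -
  have "finite (UNIV :: bit set)" by (rule finite_subset[of _ "{0, 1}"]) auto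
  then show ?thesis by (simp add: idx_def)
qed

definition bas :: "bit \<times> nat \<times> nat \<Rightarrow> free_alg" where
  "bas = (\<lambda>(d, s, r). nword d s r)"

definition dual :: "bit \<times> nat \<times> nat \<Rightarrow> free_alg \<Rightarrow> complex" where
  "dual = (\<lambda>(d, s, r). coef d (kinv (nword_val s r)))"

text \<open>Divisibility by 2N forces \<open>s\<close> and \<open>s'\<close> to have the same
  parity, so the twist disappears. Then \<open>r\<close> and \<open>r'\<close> are congruent modulo
  \<open>L\<close> and in the same range, hence equal, and likewise \<open>s\<close> and
  \<open>s'\<close>.\<close>

lemma tau_nword_val:
  assumes "s \<in> {1..2 * N}" "s' \<in> {1..2 * N}" "r < L" "r' < L"
  shows "tau d (kmult (kinv (nword_val s r)) (nword_val s' r')) = of_bool (s = s' \<and> r = r')"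
proof -
  have eq: "kmult (kinv (nword_val s r)) (nword_val s' r')
      = (int s' + 2 * int r' - (int s + 2 * int r), int r' - sign_int (int s') * sign_int (int s) * int r)"
    by (simp add: kmult_def kinv_def)
  have "s = s' \<and> r = r'"
    if dvd: "2 * int N dvd int s' + 2 * int r' - (int s + 2 * int r)"
      and "int L dvd int r' - sign_int (int s') * sign_int (int s) * int r"
  proof -
    have "even (int s' + 2 * int r' - (int s + 2 * int r))"
      using dvd by (meson dvd_mult_left)
    then have "sign_int (int s') * sign_int (int s) = 1" by (auto simp: sign_int_def)
    with that have "int L dvd int r' - int r" by simp
    moreover have "\<bar>int r' - int r\<bar> < int L" using assms by auto
    ultimately have r: "r = r'"
      using dvd_imp_le_int[of "int r' - int r" "int L"] by (cases "int r' - int r = 0") auto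
    with dvd have "2 * int N dvd int s' - int s" by simp
    moreover have "\<bar>int s' - int s\<bar> < 2 * int N" using assms by auto
    ultimately have "s = s'"
      using dvd_imp_le_int[of "int s' - int s" "2 * int N"] by (cases "int s' - int s = 0") auto
    with r show ?thesis by simp
  qed
  then show ?thesis unfolding eq tau_def fst_conv snd_conv by (auto simp: sign_pow_def)
qed

lemma dual_bas: "i \<in> idx \<Longrightarrow> j \<in> idx \<Longrightarrow> dual i (bas j) = of_bool (i = j)"
  by (cases i; cases j)
    (auto simp add: idx_def dual_def bas_def coef_def lin_eval_nword tau_nword_val simp del: kmult_kinv)

section \<open>Normal words span the quotient\<close>

definition expand :: "free_alg \<Rightarrow> free_alg" where
  "expand f = (\<Sum>i\<in>idx. scalar (dual i f) * bas i)"

lemma dual_simps [simp]: "dual i 0 = 0" "dual i (f + f') = dual i f + dual i f'"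
  "dual i (scalar c * f) = c * dual i f" "dual i (sum F S) = (\<Sum>j\<in>S. dual i (F j))"
  by (cases i; simp add: dual_def)+

lemma dual_cong: "f \<approx> f' \<Longrightarrow> dual i f = dual i f'"
  by (cases i) (simp add: dual_def coef_cong)

lemma expand_bas: "j \<in> idx \<Longrightarrow> expand (bas j) = bas j"
proof -
  assume j: "j \<in> idx"
  have "expand (bas j) = (\<Sum>i\<in>idx. if i = j then bas j else 0)"
    unfolding expand_def by (rule sum.cong) (auto simp: dual_bas j scalar_simps)
  then show ?thesis using j by simp
qed

lemma expand_add: "expand (f + f') = expand f + expand f'"
  by (simp add: expand_def scalar_simps distrib_right sum.distrib)

lemma expand_scalar: "expand (scalar c * f) = scalar c * expand f"
  by (simp add: expand_def sum_distrib_left mult.assoc[symmetric] scalar_simps)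

lemma expand_eqvI: "f \<approx> g \<Longrightarrow> g \<approx> expand g \<Longrightarrow> f \<approx> expand f"
proof -
  assume *: "f \<approx> g" "g \<approx> expand g"
  have "expand f = expand g" by (simp add: expand_def dual_cong[OF *(1)])
  then show ?thesis using eqv_trans[OF *] by simp
qed

text \<open>The elements congruent to their expansion form a subspace that contains the normal words
  and, by \<open>gen_nword\<close>, is preserved when a letter is put in front. Induction on words
  then reaches everything.\<close>

lemma eqv_expand: "f \<approx> expand f"
proof -
  have add: "f + g \<approx> expand (f + g)" if "f \<approx> expand f" "g \<approx> expand g" for f g
    using that by (simp add: expand_add eqv_add)
  have scal: "scalar c * f \<approx> expand (scalar c * f)" if "f \<approx> expand f" for f c
    using that by (simp add: expand_scalar eqv_mult)
  have zero: "0 \<approx> expand 0" by (simp add: expand_def scalar_simps)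
  have nword: "nword d s r \<approx> expand (nword d s r)" if "s \<in> {1..2 * N}" "r < L" for d s r
    using expand_bas[of "(d, s, r)"] that by (simp add: bas_def idx_def)
  have sum: "sum F S \<approx> expand (sum F S)" if "\<And>i. i \<in> S \<Longrightarrow> F i \<approx> expand (F i)" for F and S :: "'b set"
    using that by (induction S rule: infinite_finite_induct) (auto intro: add zero)
  have word: "Poly_Mapping.single (FM l) 1 \<approx> expand (Poly_Mapping.single (FM l) 1)" for l
  proof (induction l)
    case Nil
    \<comment> \<open>The empty word is not normal, but the relation for 1 writes it as a
      combination of two normal words, one of each type.\<close>
    have "ga 0 ^ (2 * N) + scalar \<alpha> * ga 1 ^ (2 * N) \<approx> expand (ga 0 ^ (2 * N) + scalar \<alpha> * ga 1 ^ (2 * N))"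
      using nword[of "2 * N" 0 0] nword[of "2 * N" 0 1] N_pos L_ge
      by (intro add scal) (auto simp: nword_def)
    with expand_eqvI[OF one_eqv] show ?case by (simp flip: zero_fmonoid_def)
  next
    case (Cons x l)
    obtain i j where x: "x = (i, j)" by (cases x)
    have eq: "Poly_Mapping.single (FM (x # l)) 1 = gen i j * Poly_Mapping.single (FM l) (1 :: complex)"
      by (simp add: gen_def mult_single plus_fmonoid_def x)
    have "gen i j * bas k \<approx> expand (gen i j * bas k)" if k: "k \<in> idx" for k
    proof -
      obtain d s r where k': "k = (d, s, r)" "s \<in> {1..2 * N}" "r < L"
        using k by (auto simp: idx_def)
      have "s \<ge> 1" using k' by simp
      from gen_nword[OF this, of i j d r] show ?thesis
      proof (elim disjE bexE exE conjE)
        assume "gen i j * nword d s r \<approx> 0"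
        then show ?thesis using zero unfolding k' bas_def prod.case by (rule expand_eqvI)
      next
        fix s' r' assume *: "s' \<in> {1..2 * N}" "r' < L" "gen i j * nword d s r \<sim> nword d s' r'"
        then obtain c where "gen i j * nword d s r \<approx> scalar c * nword d s' r'"
          by (auto simp: sim_iff)
        then show ?thesis unfolding k' bas_def prod.case
          by (rule expand_eqvI) (intro scal nword *)
      qed
    qed
    then have "(\<Sum>k\<in>idx. scalar (dual k (Poly_Mapping.single (FM l) 1)) * (gen i j * bas k))
      \<approx> expand (\<Sum>k\<in>idx. scalar (dual k (Poly_Mapping.single (FM l) 1)) * (gen i j * bas k))"
      by (intro sum scal)
    also have "(\<Sum>k\<in>idx. scalar (dual k (Poly_Mapping.single (FM l) 1)) * (gen i j * bas k))
        = gen i j * expand (Poly_Mapping.single (FM l) 1)"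
      unfolding expand_def sum_distrib_left
      by (rule sum.cong) (auto simp: mult.assoc[symmetric] scalar_commute)
    finally have fixed: "gen i j * expand (Poly_Mapping.single (FM l) 1)
      \<approx> expand (gen i j * expand (Poly_Mapping.single (FM l) 1))" .
    have "gen i j * Poly_Mapping.single (FM l) 1 \<approx> gen i j * expand (Poly_Mapping.single (FM l) 1)"
      by (rule eqv_mult[OF eqv_refl Cons])
    then show ?case unfolding eq using fixed by (rule expand_eqvI)
  qed
  have "Poly_Mapping.single w c \<approx> expand (Poly_Mapping.single w c)" for w c
    using scal[OF word[of "letters w"], of c] by (cases w) (simp flip: single_eq_scalar_mult)
  then show ?thesis
    by (induction f rule: poly_mapping_induct) (auto intro: add)
qed

text \<open>The functionals \<open>coef\<close> separate the quotient, because they determine the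
  expansion.\<close>

lemma eqvI: "(\<And>d g. coef d g f = coef d g f') \<Longrightarrow> f \<approx> f'"
proof -
  assume "\<And>d g. coef d g f = coef d g f'"
  then have "expand f = expand f'" by (simp add: expand_def dual_def case_prod_beta)
  then show ?thesis using eqv_trans[of f "expand f" f'] eqv_expand[of f] eqv_sym[OF eqv_expand[of f']] by simp
qed

end

section \<open>Tensor classes\<close>

lemma lin_eval_tensor_null:
  assumes "s \<in> tensor_null V n"
    and "\<And>us ws a b. \<lbrakk>set us \<subseteq> carrier V; set ws \<subseteq> carrier V; a \<in> carrier V; b \<in> carrier V;
      length us + 1 + length ws = n\<rbrakk> \<Longrightarrow>
      \<phi> (us @ [a \<oplus>\<^bsub>V\<^esub> b] @ ws) = \<phi> (us @ [a] @ ws) + \<phi> (us @ [b] @ ws)"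
    and "\<And>us ws a k. \<lbrakk>set us \<subseteq> carrier V; set ws \<subseteq> carrier V; a \<in> carrier V;
      length us + 1 + length ws = n\<rbrakk> \<Longrightarrow>
      \<phi> (us @ [k \<odot>\<^bsub>V\<^esub> a] @ ws) = k * \<phi> (us @ [a] @ ws)"
  shows "lin_eval \<phi> s = 0"
  using assms(1)
proof induction
  case (additive us ws a b c)
  from assms(2)[OF this] show ?case
    unfolding lin_eval_diff lin_eval_single by (simp only:) (simp add: algebra_simps)
next
  case (homogeneous us ws a k c)
  from assms(3)[OF this] show ?case
    unfolding lin_eval_diff lin_eval_single by (simp only:) (simp add: algebra_simps)
qed auto

text \<open>The maps on tensor classes pick an arbitrary representative; these two properties are
  all that is used about it.\<close>

lemma rep_tensor_class:
  assumes "s \<in> formal_tensors V n"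
  shows "rep (tensor_class V n s) \<in> formal_tensors V n"
    and "rep (tensor_class V n s) - s \<in> tensor_null V n"
proof -
  have "s \<in> tensor_class V n s"
    using assms by (simp add: tensor_class_def tensor_null.zero)
  then have "rep (tensor_class V n s) \<in> tensor_class V n s"
    unfolding rep_def by (rule someI)
  then show "rep (tensor_class V n s) \<in> formal_tensors V n"
    and "rep (tensor_class V n s) - s \<in> tensor_null V n"
    by (auto simp: tensor_class_def)
qed

section \<open>The quotient algebra\<close>

context suzuki
begin

abbreviation "cls \<equiv> suzuki_class N L \<alpha> \<beta>"
abbreviation "H \<equiv> suzuki_hopf N L \<alpha> \<beta>"
abbreviation "A \<equiv> suzuki_algebra N L \<alpha> \<beta>"

lemma mem_cls: "x \<in> cls f \<longleftrightarrow> x \<approx> f"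
proof -
  have "x \<in> cls f \<longleftrightarrow> (\<exists>k\<in>ker. x = k + f)"
    by (simp add: suzuki_class_def a_r_coset_def')
  also have "\<dots> \<longleftrightarrow> x \<approx> f"
    by (auto simp: eqv_def intro: bexI[of _ "x - f"])
  finally show ?thesis .
qed

lemma cls_eq: "cls f = cls g \<longleftrightarrow> f \<approx> g"
proof
  assume "cls f = cls g"
  then show "f \<approx> g" using mem_cls[of f f] by (simp add: mem_cls)
next
  assume "f \<approx> g"
  then have "x \<approx> f \<longleftrightarrow> x \<approx> g" for x
    using eqv_trans[of x f g] eqv_trans[of x g f] eqv_sym[of f g] by blast
  then show "cls f = cls g" by (auto simp: mem_cls)
qed

lemma carrier_H: "carrier H = range cls"
  by (auto simp: suzuki_hopf_def suzuki_algebra_def Let_def FactRing_def A_RCOSETS_def' suzuki_class_def)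

lemma carrier_A: "carrier A = carrier H"
  by (simp add: suzuki_hopf_def Let_def)

lemma cls_carrier [simp]: "cls f \<in> carrier H"
  by (simp add: carrier_H)

lemma carrierE: assumes "X \<in> carrier H" obtains f where "X = cls f"
  using assms by (auto simp: carrier_H)

lemma rep_cls: "rep (cls f) \<approx> f"
proof -
  have "f \<in> cls f" by (simp add: mem_cls)
  then have "rep (cls f) \<in> cls f" unfolding rep_def by (rule someI)
  then show ?thesis by (simp add: mem_cls)
qed

lemma cls_rep: "X \<in> carrier H \<Longrightarrow> cls (rep X) = X"
  by (elim carrierE) (simp add: cls_eq rep_cls)

lemma cls_mult [simp]: "cls f \<otimes>\<^bsub>H\<^esub> cls g = cls (f * g)"
proof -
  interpret ideal ker free_ring by (rule ideal_ker)
  have "cls f \<otimes>\<^bsub>H\<^esub> cls g = rcoset_mult free_ring ker (cls f) (cls g)"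
    by (simp add: suzuki_hopf_def suzuki_algebra_def Let_def FactRing_def)
  also have "\<dots> = cls (f * g)"
    unfolding suzuki_class_def using rcoset_mult_add[of f g] by simp
  finally show ?thesis .
qed

lemma cls_add [simp]: "cls f \<oplus>\<^bsub>H\<^esub> cls g = cls (f + g)"
proof -
  have "cls f \<oplus>\<^bsub>H\<^esub> cls g = (\<Union>x\<in>cls f. \<Union>y\<in>cls g. {x + y})"
    by (simp add: suzuki_hopf_def suzuki_algebra_def Let_def FactRing_def set_add_def set_mult_def)
  also have "\<dots> = cls (f + g)"
  proof (intro equalityI subsetI)
    fix z assume "z \<in> cls (f + g)"
    then have "z - g \<approx> f" by (simp add: mem_cls eqv_def algebra_simps)
    then show "z \<in> (\<Union>x\<in>cls f. \<Union>y\<in>cls g. {x + y})"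
      by (intro UN_I[of "z - g"] UN_I[of g]) (simp_all add: mem_cls)
  qed (auto simp: mem_cls intro: eqv_add)
  finally show ?thesis .
qed

lemma one_H: "\<one>\<^bsub>H\<^esub> = cls 1"
  by (simp add: suzuki_hopf_def suzuki_algebra_def Let_def FactRing_def suzuki_class_def)

lemma zero_H: "\<zero>\<^bsub>H\<^esub> = cls 0"
proof -
  have "\<zero>\<^bsub>H\<^esub> = ker"
    by (simp add: suzuki_hopf_def suzuki_algebra_def Let_def FactRing_def)
  also have "\<dots> = cls 0" by (auto simp: mem_cls eqv_def)
  finally show ?thesis .
qed

lemma cls_smult [simp]: "c \<odot>\<^bsub>H\<^esub> cls f = cls (scalar c * f)"
proof -
  have "c \<odot>\<^bsub>H\<^esub> cls f = cls (scalar c) \<otimes>\<^bsub>H\<^esub> cls f"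
    by (simp add: suzuki_hopf_def suzuki_algebra_def Let_def)
  then show ?thesis by simp
qed

lemma A_ops: "X \<oplus>\<^bsub>A\<^esub> Y = X \<oplus>\<^bsub>H\<^esub> Y" "c \<odot>\<^bsub>A\<^esub> X = c \<odot>\<^bsub>H\<^esub> X"
  by (simp_all add: suzuki_hopf_def Let_def)

lemma ring_H: "ring H"
proof (intro ringI abelian_groupI monoidI)
  fix X assume "X \<in> carrier H"
  then obtain f where "X = cls f" by (rule carrierE)
  then show "\<exists>Y\<in>carrier H. Y \<oplus>\<^bsub>H\<^esub> X = \<zero>\<^bsub>H\<^esub>"
    by (intro bexI[of _ "cls (- f)"]) (simp_all add: zero_H)
qed (auto elim!: carrierE simp: one_H zero_H algebra_simps)

sublocale HR: ring H
  by (rule ring_H)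

lemma smult_closed [simp]: "X \<in> carrier H \<Longrightarrow> c \<odot>\<^bsub>H\<^esub> X \<in> carrier H"
  by (elim carrierE) simp

lemma finsum_cls: "finite S \<Longrightarrow> finsum H (\<lambda>i. cls (F i)) S = cls (sum F S)"
  by (induction S rule: finite_induct) (auto simp: zero_H HR.finsum_insert)

section \<open>Linear functionals on the quotient\<close>

definition linear_H :: "(free_alg set \<Rightarrow> complex) \<Rightarrow> bool" where
  "linear_H F \<longleftrightarrow> (\<forall>f g. F (cls (f + g)) = F (cls f) + F (cls g)) \<and>
     (\<forall>c f. F (cls (scalar c * f)) = c * F (cls f))"

lemma linear_H_sum:
  assumes "linear_H F"
  shows "F (cls (\<Sum>i\<in>S. scalar (c i) * f i)) = (\<Sum>i\<in>S. c i * F (cls (f i)))"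
proof -
  have "F (cls (scalar 0 * 0)) = 0 * F (cls 0)"
    using assms unfolding linear_H_def by blast
  then show ?thesis using assms
    by (induction S rule: infinite_finite_induct) (auto simp: linear_H_def)
qed

lemma linear_H_expand:
  assumes "linear_H F"
  shows "F (cls f) = (\<Sum>j\<in>idx. dual j f * F (cls (bas j)))"
proof -
  have "cls f = cls (expand f)" by (simp add: cls_eq eqv_expand)
  then show ?thesis by (simp add: expand_def linear_H_sum[OF assms])
qed

definition coefH :: "bit \<Rightarrow> int \<times> int \<Rightarrow> free_alg set \<Rightarrow> complex" where
  "coefH d g X = coef d g (rep X)"

lemma coefH_cls [simp]: "coefH d g (cls f) = coef d g f"
  unfolding coefH_def by (rule coef_cong[OF rep_cls])

lemma linear_coefH: "linear_H (coefH d g)"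
  by (simp add: linear_H_def)

lemma coefH_eqI: "X \<in> carrier H \<Longrightarrow> Y \<in> carrier H \<Longrightarrow> (\<And>d g. coefH d g X = coefH d g Y) \<Longrightarrow> X = Y"
  by (elim carrierE) (simp add: cls_eq eqvI)

lemma linear_coefH_mult: "linear_H (\<lambda>Y. coefH d g (cls f \<otimes>\<^bsub>H\<^esub> Y))"
  by (simp add: linear_H_def distrib_left scalar_mult_left)

section \<open>The regular character\<close>

lemma lin_comb_cls:
  assumes "length bs = length l" "\<And>i. i < length l \<Longrightarrow> bs ! i = cls (F (l ! i))"
  shows "lin_comb H bs cs = cls (\<Sum>i<length l. scalar (cs ! i) * F (l ! i))"
proof -
  have "lin_comb H bs cs = finsum H (\<lambda>i. cls (scalar (cs ! i) * F (l ! i))) {..<length l}"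
    unfolding lin_comb_def assms(1) by (rule HR.finsum_cong') (auto simp: assms(2))
  then show ?thesis by (simp add: finsum_cls)
qed

text \<open>The normal words form a basis: \<open>expand\<close> gives existence of coordinates, and
  the biorthogonality \<open>dual_bas\<close> gives uniqueness.\<close>

lemma ex_basis: "\<exists>bs. is_basis H bs"
proof -
  obtain l where l: "set l = idx" "distinct l"
    using finite_distinct_list[OF finite_idx] by blast
  define bs where "bs = map (\<lambda>j. cls (bas j)) l"
  have len: "length bs = length l" by (simp add: bs_def)
  have lc: "lin_comb H bs cs = cls (\<Sum>i<length l. scalar (cs ! i) * bas (l ! i))" for cs
    by (rule lin_comb_cls) (auto simp: bs_def)
  have nth: "l ! i \<in> idx" if "i < length l" for i
    using nth_mem[OF that] by (simp add: l)
  have dual: "dual (l ! k) (\<Sum>i<length l. scalar (cs ! i) * bas (l ! i)) = cs ! k"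
    if "k < length l" for cs k
  proof -
    have "dual (l ! k) (\<Sum>i<length l. scalar (cs ! i) * bas (l ! i))
       = (\<Sum>i<length l. if i = k then cs ! k else 0)"
      unfolding dual_simps
      by (rule sum.cong) (use that l in \<open>auto simp: dual_bas nth nth_eq_iff_index_eq\<close>)
    with that show ?thesis by simp
  qed
  have "\<exists>!cs. length cs = length bs \<and> lin_comb H bs cs = v" if v_carrier: "v \<in> carrier H" for v
  proof -
    obtain f where v: "v = cls f" using v_carrier by (rule carrierE)
    have sum_l: "(\<Sum>i<length l. g (l ! i)) = (\<Sum>j\<in>idx. g j)" for g :: "_ \<Rightarrow> free_alg"
      unfolding l(1)[symmetric] using bij_betw_nth[OF l(2) refl refl]
      by (rule sum.reindex_bij_betw)
    show ?thesis
    proof (rule ex1I[of _ "map (\<lambda>j. dual j f) l"])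
      have "(\<Sum>i<length l. scalar (map (\<lambda>j. dual j f) l ! i) * bas (l ! i)) = expand f"
        by (simp add: expand_def sum_l[of "\<lambda>j. scalar (dual j f) * bas j", symmetric])
      then show "length (map (\<lambda>j. dual j f) l) = length bs \<and> lin_comb H bs (map (\<lambda>j. dual j f) l) = v"
        by (simp add: len lc v cls_eq eqv_sym[OF eqv_expand])
    next
      fix cs assume cs: "length cs = length bs \<and> lin_comb H bs cs = v"
      then have "(\<Sum>i<length l. scalar (cs ! i) * bas (l ! i)) \<approx> f" by (simp add: lc v cls_eq)
      then have "dual (l ! k) (\<Sum>i<length l. scalar (cs ! i) * bas (l ! i)) = dual (l ! k) f" for k
        by (rule dual_cong)
      then have "cs ! k = dual (l ! k) f" if "k < length l" for k
        using dual[OF that, of cs] by (simp only:)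
      then show "cs = map (\<lambda>j. dual j f) l"
        using cs by (intro nth_equalityI) (auto simp: len)
    qed
  qed
  moreover have "set bs \<subseteq> carrier H" by (auto simp: bs_def)
  ultimately show ?thesis unfolding is_basis_def by blast
qed

text \<open>Stated for any basis, since \<open>lin_trace\<close> works with an unspecified
  one.\<close>

lemma basis_coords:
  assumes "is_basis H bs"
  shows "v \<in> carrier H \<Longrightarrow> lin_comb H bs (coords H bs v) = v"
    and "v \<in> carrier H \<Longrightarrow> length (coords H bs v) = length bs"
    and "i < length bs \<Longrightarrow> linear_H (\<lambda>v. coords H bs v ! i)"
proof -
  have ex1: "\<exists>!cs. length cs = length bs \<and> lin_comb H bs cs = v" if "v \<in> carrier H" for v
    using assms that by (auto simp: is_basis_def)
  have coords: "length (coords H bs v) = length bs \<and> lin_comb H bs (coords H bs v) = v"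
    if "v \<in> carrier H" for v
    unfolding coords_def by (rule theI'[OF ex1[OF that]])
  then show "v \<in> carrier H \<Longrightarrow> lin_comb H bs (coords H bs v) = v"
    and "v \<in> carrier H \<Longrightarrow> length (coords H bs v) = length bs" by auto
  have eqI: "coords H bs v = cs" if "v \<in> carrier H" "length cs = length bs" "lin_comb H bs cs = v" for v cs
    using ex1[OF that(1)] coords[OF that(1)] that by blast
  have lc: "lin_comb H bs cs = cls (\<Sum>k<length bs. scalar (cs ! k) * rep (bs ! k))" for cs
    by (rule lin_comb_cls) (use assms cls_rep nth_mem in \<open>auto simp: is_basis_def subset_iff\<close>)
  assume i: "i < length bs"
  show "linear_H (\<lambda>v. coords H bs v ! i)"
    unfolding linear_H_def
  proof (intro conjI allI)
    fix f g
    let ?c = "coords H bs (cls f)" and ?d = "coords H bs (cls g)"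
    have "coords H bs (cls (f + g)) = map (\<lambda>k. ?c ! k + ?d ! k) [0..<length bs]"
    proof (rule eqI)
      have "(\<Sum>k<length bs. scalar (map (\<lambda>k. ?c ! k + ?d ! k) [0..<length bs] ! k) * rep (bs ! k))
        = (\<Sum>k<length bs. scalar (?c ! k) * rep (bs ! k)) + (\<Sum>k<length bs. scalar (?d ! k) * rep (bs ! k))"
        by (simp add: scalar_simps distrib_right sum.distrib)
      then have "lin_comb H bs (map (\<lambda>k. ?c ! k + ?d ! k) [0..<length bs])
          = lin_comb H bs ?c \<oplus>\<^bsub>H\<^esub> lin_comb H bs ?d"
        by (simp add: lc)
      then show "lin_comb H bs (map (\<lambda>k. ?c ! k + ?d ! k) [0..<length bs]) = cls (f + g)"
        by (simp add: coords)
    qed simp_all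
    with i show "coords H bs (cls (f + g)) ! i = ?c ! i + ?d ! i" by simp
  next
    fix c f
    let ?c = "coords H bs (cls f)"
    have "coords H bs (cls (scalar c * f)) = map (\<lambda>k. c * ?c ! k) [0..<length bs]"
    proof (rule eqI)
      have "(\<Sum>k<length bs. scalar (map (\<lambda>k. c * ?c ! k) [0..<length bs] ! k) * rep (bs ! k))
        = scalar c * (\<Sum>k<length bs. scalar (?c ! k) * rep (bs ! k))"
        by (simp add: sum_distrib_left scalar_scalar_mult)
      then have "lin_comb H bs (map (\<lambda>k. c * ?c ! k) [0..<length bs]) = c \<odot>\<^bsub>H\<^esub> lin_comb H bs ?c"
        by (simp add: lc)
      then show "lin_comb H bs (map (\<lambda>k. c * ?c ! k) [0..<length bs]) = cls (scalar c * f)"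
        by (simp add: coords)
    qed simp_all
    with i show "coords H bs (cls (scalar c * f)) ! i = c * ?c ! i" by simp
  qed
qed

lemma dual_rep_cls [simp]: "dual j (rep (cls f)) = dual j f"
  by (rule dual_cong[OF rep_cls])

text \<open>Basis independence of the trace in this instance: the vectors of the unspecified basis
  are expanded in normal words, and the two sums are exchanged.\<close>

lemma lin_trace_mult:
  "lin_trace H (\<lambda>X. cls f \<otimes>\<^bsub>H\<^esub> X) = (\<Sum>j\<in>idx. dual j (f * bas j))"
proof -
  define bs where "bs = (SOME bs. is_basis H bs)"
  have bs: "is_basis H bs" unfolding bs_def by (rule someI_ex[OF ex_basis])
  let ?n = "length bs"
  define b where "b i = rep (bs ! i)" for i
  have b: "bs ! i = cls (b i)" if "i < ?n" for i
  proof -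
    have "bs ! i \<in> carrier H" using bs nth_mem[OF that] by (auto simp: is_basis_def)
    then show ?thesis by (simp add: b_def cls_rep)
  qed
  have lc: "lin_comb H bs cs = cls (\<Sum>k<?n. scalar (cs ! k) * b k)" for cs
    unfolding b_def by (rule lin_comb_cls[OF refl]) (rule b[unfolded b_def])
  have lin: "linear_H (\<lambda>Y. coords H bs (cls f \<otimes>\<^bsub>H\<^esub> Y) ! i)" if "i < ?n" for i
    using basis_coords(3)[OF bs that]
    by (simp add: linear_H_def distrib_left scalar_mult_left)
  have "lin_trace H (\<lambda>X. cls f \<otimes>\<^bsub>H\<^esub> X) = (\<Sum>i<?n. coords H bs (cls f \<otimes>\<^bsub>H\<^esub> cls (b i)) ! i)"
    by (simp add: lin_trace_def b flip: bs_def)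
  also have "\<dots> = (\<Sum>i<?n. \<Sum>j\<in>idx. dual j (b i) * coords H bs (cls f \<otimes>\<^bsub>H\<^esub> cls (bas j)) ! i)"
    by (intro sum.cong refl linear_H_expand[OF lin]) simp
  also have "\<dots> = (\<Sum>j\<in>idx. \<Sum>i<?n. dual j (b i) * coords H bs (cls f \<otimes>\<^bsub>H\<^esub> cls (bas j)) ! i)"
    by (rule sum.swap)
  \<comment> \<open>The inner sum is \<open>dual j\<close> applied to the expansion of
    \<open>f * bas j\<close> in the unspecified basis.\<close>
  also have "\<dots> = (\<Sum>j\<in>idx. dual j (f * bas j))"
  proof (intro sum.cong refl)
    fix j
    let ?cs = "coords H bs (cls f \<otimes>\<^bsub>H\<^esub> cls (bas j))"
    have "cls (\<Sum>k<?n. scalar (?cs ! k) * b k) = cls (f * bas j)"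
      using basis_coords(1)[OF bs, of "cls f \<otimes>\<^bsub>H\<^esub> cls (bas j)"] by (simp add: lc)
    then have "dual j (\<Sum>k<?n. scalar (?cs ! k) * b k) = dual j (f * bas j)"
      by (intro dual_cong) (simp add: cls_eq)
    then show "(\<Sum>i<?n. dual j (b i) * ?cs ! i) = dual j (f * bas j)"
      by (simp add: mult.commute)
  qed
  finally show ?thesis .
qed

text \<open>By the trace property the diagonal entry at a group element b, the unit coefficient of
  b^-1 f b, is that of f. Each type has 2NL such entries.\<close>

lemma regular_character_cls:
  "regular_character H (cls f) = of_nat (2 * N * L) * (coef 0 (0, 0) f + coef 1 (0, 0) f)"
proof -
  have "regular_character H (cls f) = (\<Sum>j\<in>idx. dual j (f * bas j))"
    unfolding regular_character_def by (rule lin_trace_mult)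
  also have "\<dots> = (\<Sum>j\<in>idx. coef (fst j) (0, 0) f)"
  proof (intro sum.cong refl)
    fix j assume "j \<in> idx"
    then obtain d s r where j: "j = (d, s, r)" "s \<ge> 1" by (auto simp: idx_def)
    then show "dual j (f * bas j) = coef (fst j) (0, 0) f"
      by (simp add: dual_def bas_def coef_mult_right lin_eval_nword)
  qed
  also have "\<dots> = (\<Sum>d\<in>UNIV. \<Sum>k\<in>{1..2 * N} \<times> {..<L}. coef d (0, 0) f)"
    unfolding idx_def sum.cartesian_product by (rule sum.cong) auto
  also have "\<dots> = of_nat (2 * N * L) * (coef 0 (0, 0) f + coef 1 (0, 0) f)"
    by (simp add: sum_bit card_cartesian_product algebra_simps)
  finally show ?thesis .
qed

section \<open>The integral\<close>

definition haar :: free_alg where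
  "haar = scalar (1 / of_nat (2 * N * L)) * (\<Sum>(s, r)\<in>{1..2 * N} \<times> {..<L}. nword 0 s r)"

lemma lin_eval_haar:
  "lin_eval (pure_eval t \<psi>) haar =
     (if t = 0 then (\<Sum>s\<in>{1..2 * N}. \<Sum>r<L. \<psi> (nword_val s r)) / of_nat (2 * N * L) else 0)"
proof -
  have "lin_eval (pure_eval t \<psi>) haar = 1 / of_nat (2 * N * L) *
     (\<Sum>(s, r)\<in>{1..2 * N} \<times> {..<L}. lin_eval (pure_eval t \<psi>) (nword 0 s r))"
    by (simp add: haar_def case_prod_beta)
  also have "(\<Sum>(s, r)\<in>{1..2 * N} \<times> {..<L}. lin_eval (pure_eval t \<psi>) (nword 0 s r))
    = (\<Sum>(s, r)\<in>{1..2 * N} \<times> {..<L}. if t = 0 then \<psi> (nword_val s r) else 0)"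
    by (intro sum.cong refl) (auto simp: lin_eval_nword)
  also have "\<dots> = (\<Sum>s\<in>{1..2 * N}. \<Sum>r<L. if t = 0 then \<psi> (nword_val s r) else 0)"
    by (simp add: sum.cartesian_product)
  finally show ?thesis by simp
qed

text \<open>Exactly one normal word of type 0 represents the inverse of \<open>g\<close>.\<close>

lemma sum_tau: "(\<Sum>s\<in>{1..2 * N}. \<Sum>r<L. tau 0 (kmult g (nword_val s r))) = 1"
proof -
  obtain x y where g: "g = (x, y)" by (cases g)
  have eq: "tau 0 (kmult g (nword_val s r)) =
      of_bool (int (2 * N) dvd int s + (x + 2 * int r)) * of_bool (int L dvd int r + sign_int x * y)" for s r
  proof -
    \<comment> \<open>The first divisibility fixes the parity of \<open>s\<close>, so the second no
      longer depends on \<open>s\<close> and the sum over \<open>s\<close> can be done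
      first.\<close>
    have "sign_int (int s) = sign_int x" if "int (2 * N) dvd int s + (x + 2 * int r)"
    proof -
      have "even (int s + (x + 2 * int r))" by (rule dvd_trans[OF _ that]) simp
      then have "even (int s) \<longleftrightarrow> even x" by presburger
      then show ?thesis by (simp add: sign_int_def)
    qed
    moreover have "sign_int (z * 2) = 1" for z by (simp add: sign_int_def)
    ultimately show ?thesis
      by (auto simp: g tau_def kmult_def wt_def vt_def sign_pow_def algebra_simps)
  qed
  have "(\<Sum>s\<in>{1..2 * N}. \<Sum>r<L. tau 0 (kmult g (nword_val s r)))
    = (\<Sum>r<L. \<Sum>s\<in>{1..2 * N}. of_bool (int (2 * N) dvd int s + (x + 2 * int r)) * of_bool (int L dvd int r + sign_int x * y))"
    unfolding eq by (rule sum.swap)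
  also have "\<dots> = (\<Sum>r<L. (\<Sum>s\<in>{1..2 * N}. of_bool (int (2 * N) dvd int s + (x + 2 * int r))) * of_bool (int L dvd int r + sign_int x * y))"
    by (simp add: sum_distrib_right)
  also have "\<dots> = (\<Sum>r<L. 1 * of_bool (int L dvd int r + sign_int x * y))"
  proof (intro sum.cong refl arg_cong2[where f = "(*)"])
    fix r
    have "(\<Sum>s\<in>{1..2 * N}. of_bool (int (2 * N) dvd int s + (x + 2 * int r)))
      = (\<Sum>s<2 * N. of_bool (int (2 * N) dvd int s) :: complex)"
      by (rule periodic_sum_atLeast1) simp
    then show "(\<Sum>s\<in>{1..2 * N}. of_bool (int (2 * N) dvd int s + (x + 2 * int r))) = (1 :: complex)"
      using sum_dvd_less[of "2 * N"] N_pos by simp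
  qed
  also have "\<dots> = 1"
    using periodic_sum[of "\<lambda>x. of_bool (int L dvd x)" L "sign_int x * y"] sum_dvd_less[of L] L_ge by simp
  finally show ?thesis .
qed

lemma coef_haar: "coef d g haar = (if d = 0 then 1 / of_nat (2 * N * L) else 0)"
  unfolding coef_def lin_eval_haar using sum_tau[of g] by (cases "d = 0") simp_all

text \<open>The counit is the functional of type 0 given by the constant function 1, which is
  quasi-periodic.\<close>

lemma free_counit_cong: "f \<approx> f' \<Longrightarrow> free_counit f = free_counit f'"
proof -
  assume *: "f \<approx> f'"
  have "quasi_periodic 0 (\<lambda>_. 1)" by (simp add: quasi_periodic_def wt_def vt_def)
  from quasi_periodic_ker[OF this, of "f - f'"] * show ?thesis
    by (simp add: eqv_def lin_eval_free_counit pure_eval_def[abs_def])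
qed

lemma counit_cls [simp]: "counit H (cls f) = free_counit f"
proof -
  have "counit H (cls f) = free_counit (rep (cls f))"
    by (simp add: suzuki_hopf_def Let_def)
  then show ?thesis by (simp add: free_counit_cong[OF rep_cls])
qed

text \<open>Multiplication by \<open>f\<close> translates \<open>g\<close> in
  \<open>coef d g\<close>, but the coefficients of \<open>haar\<close> do not depend on
  \<open>g\<close>; what remains is the total weight of \<open>f\<close> in type 0, its
  counit.\<close>

lemma haar_mult: "f * haar \<approx> scalar (free_counit f) * haar" "haar * f \<approx> scalar (free_counit f) * haar"
proof -
  have *: "lin_eval (pure_eval d (\<lambda>u. if d = 0 then c else 0)) f = (if d = 0 then c * free_counit f else 0)" for d c
    using lin_eval_mult_left[of c "\<lambda>w. if pure 0 w then 1 else 0" f]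
    by (simp add: lin_eval_free_counit pure_eval_def[abs_def] if_distrib[of "(*) c"] cong: if_cong)
  show "f * haar \<approx> scalar (free_counit f) * haar"
    by (rule eqvI) (simp add: coef_mult_left[of _ _ f haar] coef_haar *)
  show "haar * f \<approx> scalar (free_counit f) * haar"
    by (rule eqvI) (simp add: coef_mult_right[of _ _ haar f] coef_haar *)
qed

lemma counit_haar: "free_counit haar = 1"
proof -
  have "free_counit haar = lin_eval (pure_eval 0 (\<lambda>_. 1)) haar"
    by (simp add: lin_eval_free_counit pure_eval_def[abs_def])
  then show ?thesis using N_pos L_ge by (simp add: lin_eval_haar)
qed

lemma normalized_integral_H: "normalized_integral H = cls haar"
  unfolding normalized_integral_def
proof (rule the_equality)
  let ?P = "\<lambda>\<Lambda>. \<Lambda> \<in> carrier H \<and> (\<forall>h\<in>carrier H. h \<otimes>\<^bsub>H\<^esub> \<Lambda> = counit H h \<odot>\<^bsub>H\<^esub> \<Lambda> \<and>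
    \<Lambda> \<otimes>\<^bsub>H\<^esub> h = counit H h \<odot>\<^bsub>H\<^esub> \<Lambda>) \<and> counit H \<Lambda> = 1"
  show haar: "?P (cls haar)"
  proof (intro conjI ballI)
    fix h assume "h \<in> carrier H"
    then obtain f where "h = cls f" by (rule carrierE)
    then show "h \<otimes>\<^bsub>H\<^esub> cls haar = counit H h \<odot>\<^bsub>H\<^esub> cls haar"
      "cls haar \<otimes>\<^bsub>H\<^esub> h = counit H h \<odot>\<^bsub>H\<^esub> cls haar"
      by (simp_all add: cls_eq haar_mult)
  qed (simp_all add: counit_haar)
  fix X assume X: "?P X"
  then obtain f where f: "X = cls f" by (auto elim: carrierE)
  \<comment> \<open>The product of two normalized integrals equals each of them.\<close>
  have "X \<otimes>\<^bsub>H\<^esub> cls haar = counit H (cls haar) \<odot>\<^bsub>H\<^esub> X"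
    using X cls_carrier by blast
  moreover have "X \<otimes>\<^bsub>H\<^esub> cls haar = counit H X \<odot>\<^bsub>H\<^esub> cls haar"
    using X haar by blast
  ultimately have "counit H (cls haar) \<odot>\<^bsub>H\<^esub> X = counit H X \<odot>\<^bsub>H\<^esub> cls haar" by simp
  moreover have "counit H (cls haar) = 1" "counit H X = 1" using X haar by blast+
  ultimately show "X = cls haar" by (simp add: f scalar_simps)
qed

section \<open>Convolution powers of the identity\<close>

abbreviation tprod :: "free_alg set list \<Rightarrow> free_alg set" where
  "tprod us \<equiv> foldr (monoid.mult H) us \<one>\<^bsub>H\<^esub>"

lemma tprod_closed [simp]: "set us \<subseteq> carrier H \<Longrightarrow> tprod us \<in> carrier H"
  by (induction us) auto

lemma tprod_append: "set us \<subseteq> carrier H \<Longrightarrow> set ws \<subseteq> carrier H \<Longrightarrow>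
    tprod (us @ ws) = tprod us \<otimes>\<^bsub>H\<^esub> tprod ws"
  by (induction us) (auto simp: HR.m_assoc)

lemma linear_H_add: "linear_H F \<Longrightarrow> X \<in> carrier H \<Longrightarrow> Y \<in> carrier H \<Longrightarrow> F (X \<oplus>\<^bsub>H\<^esub> Y) = F X + F Y"
  and linear_H_smult: "linear_H F \<Longrightarrow> X \<in> carrier H \<Longrightarrow> F (c \<odot>\<^bsub>H\<^esub> X) = c * F X"
  by (auto elim!: carrierE simp: linear_H_def)

lemma linear_H_finsum:
  assumes "linear_H F" "finite S" "\<And>i. i \<in> S \<Longrightarrow> X i \<in> carrier H"
  shows "F (finsum H (\<lambda>i. c i \<odot>\<^bsub>H\<^esub> X i) S) = (\<Sum>i\<in>S. c i * F (X i))"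
proof -
  have "finsum H (\<lambda>i. c i \<odot>\<^bsub>H\<^esub> X i) S = finsum H (\<lambda>i. cls (scalar (c i) * rep (X i))) S"
    using assms(3) by (intro HR.finsum_cong') (auto simp: cls_rep simp flip: cls_smult)
  then show ?thesis
    using assms linear_H_sum[OF assms(1), of c "\<lambda>i. rep (X i)" S]
    by (simp add: finsum_cls cls_rep)
qed

lemma smult_mult:
  assumes "X \<in> carrier H" "Y \<in> carrier H"
  shows "(c \<odot>\<^bsub>H\<^esub> X) \<otimes>\<^bsub>H\<^esub> Y = c \<odot>\<^bsub>H\<^esub> (X \<otimes>\<^bsub>H\<^esub> Y)" "X \<otimes>\<^bsub>H\<^esub> (c \<odot>\<^bsub>H\<^esub> Y) = c \<odot>\<^bsub>H\<^esub> (X \<otimes>\<^bsub>H\<^esub> Y)"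
  using assms by (auto elim!: carrierE simp: mult.assoc scalar_mult_left)

lemma lin_eval_tprod_null:
  assumes "s \<in> tensor_null H n" "linear_H F"
  shows "lin_eval (\<lambda>us. F (tprod us)) s = 0"
  using assms(1)
proof (rule lin_eval_tensor_null)
  fix us ws a b
  assume *: "set us \<subseteq> carrier H" "set ws \<subseteq> carrier H" "a \<in> carrier H" "b \<in> carrier H"
  then show "F (tprod (us @ [a \<oplus>\<^bsub>H\<^esub> b] @ ws)) = F (tprod (us @ [a] @ ws)) + F (tprod (us @ [b] @ ws))"
    by (subst (1 2 3) tprod_append)
      (auto simp: HR.l_distr HR.r_distr linear_H_add[OF assms(2)])
next
  fix us ws a k
  assume *: "set us \<subseteq> carrier H" "set ws \<subseteq> carrier H" "a \<in> carrier H"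
  then show "F (tprod (us @ [k \<odot>\<^bsub>H\<^esub> a] @ ws)) = k * F (tprod (us @ [a] @ ws))"
    by (subst (1 2) tprod_append)
      (auto simp: smult_mult linear_H_smult[OF assms(2)])
qed

lemma tensor_mult_class:
  assumes s: "s \<in> formal_tensors H n"
  shows "tensor_mult H (tensor_class H n s) \<in> carrier H"
    and "linear_H F \<Longrightarrow> F (tensor_mult H (tensor_class H n s)) = lin_eval (\<lambda>us. F (tprod us)) s"
proof -
  let ?t = "rep (tensor_class H n s)"
  note t = rep_tensor_class[OF s]
  have us: "set us \<subseteq> carrier H" if "us \<in> Poly_Mapping.keys ?t" for us
    using t(1) that by (auto simp: formal_tensors_def)
  show "tensor_mult H (tensor_class H n s) \<in> carrier H"
    unfolding tensor_mult_def by (rule HR.finsum_closed) (use us in auto)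
  assume F: "linear_H F"
  have "F (tensor_mult H (tensor_class H n s)) = lin_eval (\<lambda>us. F (tprod us)) ?t"
    unfolding tensor_mult_def lin_eval_def
    by (rule linear_H_finsum[OF F]) (use us in auto)
  also have "\<dots> = lin_eval (\<lambda>us. F (tprod us)) s"
    using lin_eval_tprod_null[OF t(2) F] by simp
  finally show "F (tensor_mult H (tensor_class H n s)) = lin_eval (\<lambda>us. F (tprod us)) s" .
qed

definition comult_rep :: "free_alg set \<Rightarrow> (free_alg set list \<Rightarrow>\<^sub>0 complex)" where
  "comult_rep X = lin_ext (\<lambda>(u, v). Poly_Mapping.single
      [cls (Poly_Mapping.single u 1), cls (Poly_Mapping.single v 1)] 1) (free_comult (rep X))"

lemma comult_H: "comult H X = tensor_class A 2 (comult_rep X)"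
  by (simp add: suzuki_hopf_def Let_def comult_rep_def)

lemma comult_rep_formal: "comult_rep X \<in> formal_tensors A 2"
proof -
  have "Poly_Mapping.keys (comult_rep X) \<subseteq> {[cls f, cls g] | f g. True}"
    unfolding comult_rep_def by (rule order.trans[OF keys_lin_ext]) auto
  then have "length us = 2 \<and> set us \<subseteq> carrier A" if us: "us \<in> Poly_Mapping.keys (comult_rep X)" for us
  proof -
    obtain f g where "us = [cls f, cls g]" using us \<open>_ \<subseteq> {[cls f, cls g] | f g. True}\<close> by blast
    then show ?thesis by (simp add: carrier_A)
  qed
  then show ?thesis by (simp add: formal_tensors_def)
qed

definition iter_rep :: "nat \<Rightarrow> free_alg set \<Rightarrow> (free_alg set list \<Rightarrow>\<^sub>0 complex)" where
  "iter_rep n X = lin_ext (\<lambda>us. lin_ext (\<lambda>ws. Poly_Mapping.single (us ! 0 # ws) 1)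
     (rep (iterated_comult H (Suc n) (us ! 1)))) (rep (comult H X))"

text \<open>Every \<open>rep\<close> in \<open>iterated_comult\<close> is thus taken of the class of
  a formal tensor, so that \<open>rep_tensor_class\<close> applies to it.\<close>

lemma iterated_comult_formal:
  "X \<in> carrier H \<Longrightarrow> \<exists>s\<in>formal_tensors H (Suc n). iterated_comult H (Suc n) X = tensor_class H (Suc n) s"
  "iter_rep n X \<in> formal_tensors H (Suc (Suc n))"
proof -
  have step: "iter_rep n X \<in> formal_tensors H (Suc (Suc n))"
    if formal: "\<And>Y. Y \<in> carrier H \<Longrightarrow> \<exists>s\<in>formal_tensors H (Suc n). iterated_comult H (Suc n) Y = tensor_class H (Suc n) s" for n X
  proof -
    have us: "length us = 2 \<and> set us \<subseteq> carrier H" if "us \<in> Poly_Mapping.keys (rep (comult H X))" for us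
      using rep_tensor_class(1)[OF comult_rep_formal, of X] that
      by (auto simp: comult_H formal_tensors_def carrier_A)
    have "length vs = Suc (Suc n) \<and> set vs \<subseteq> carrier H" if vs: "vs \<in> Poly_Mapping.keys (iter_rep n X)" for vs
    proof -
      obtain us where us_keys: "us \<in> Poly_Mapping.keys (rep (comult H X))"
        and "vs \<in> Poly_Mapping.keys (lin_ext (\<lambda>ws. Poly_Mapping.single (us ! 0 # ws) 1)
          (rep (iterated_comult H (Suc n) (us ! 1))))"
        using subsetD[OF keys_lin_ext vs[unfolded iter_rep_def]] by blast
      from subsetD[OF keys_lin_ext this(2)] obtain ws
        where "ws \<in> Poly_Mapping.keys (rep (iterated_comult H (Suc n) (us ! 1)))" "vs = us ! 0 # ws"
        by auto
      note * = us_keys this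
      have u: "us ! 0 \<in> carrier H" "us ! 1 \<in> carrier H"
        using us[OF *(1)] by (auto simp: subset_iff)
      obtain s where "s \<in> formal_tensors H (Suc n)" "iterated_comult H (Suc n) (us ! 1) = tensor_class H (Suc n) s"
        using formal[OF u(2)] by blast
      then have "rep (iterated_comult H (Suc n) (us ! 1)) \<in> formal_tensors H (Suc n)"
        using rep_tensor_class(1) by simp
      then show ?thesis using * u by (auto simp: formal_tensors_def)
    qed
    then show ?thesis by (simp add: formal_tensors_def)
  qed
  have all: "\<forall>X\<in>carrier H. \<exists>s\<in>formal_tensors H (Suc n). iterated_comult H (Suc n) X = tensor_class H (Suc n) s" for n
  proof (induction n)
    case 0
    have "Poly_Mapping.single [X] 1 \<in> formal_tensors H (Suc 0)" if "X \<in> carrier H" for X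
      using that by (simp add: formal_tensors_def)
    then show ?case by auto
  next
    case (Suc n)
    then have "iter_rep n X \<in> formal_tensors H (Suc (Suc n))" for X by (intro step) auto
    then show ?case unfolding iterated_comult.simps iter_rep_def by blast
  qed
  then show "X \<in> carrier H \<Longrightarrow> \<exists>s\<in>formal_tensors H (Suc n). iterated_comult H (Suc n) X = tensor_class H (Suc n) s"
    by blast
  show "iter_rep n X \<in> formal_tensors H (Suc (Suc n))" by (rule step) (use all in blast)
qed

text \<open>The n-th Sweedler power, that is, the n-fold convolution power of the identity.\<close>

definition conv :: "nat \<Rightarrow> free_alg set \<Rightarrow> free_alg set" where
  "conv n X = tensor_mult H (iterated_comult H n X)"

lemma conv_closed: "X \<in> carrier H \<Longrightarrow> conv (Suc n) X \<in> carrier H"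
  using iterated_comult_formal(1)[of X n] tensor_mult_class(1) by (auto simp: conv_def)

lemma conv_1: "X \<in> carrier H \<Longrightarrow> coefH d g (conv (Suc 0) X) = coefH d g X"
  unfolding conv_def
  by (simp, subst tensor_mult_class(2)) (auto simp: formal_tensors_def linear_coefH)

text \<open>Left multiplication followed by \<open>coefH\<close> is linear, so the representative
  chosen for the inner iterated comultiplication does not matter.\<close>

lemma conv_step:
  "coefH d g (conv (Suc (Suc n)) X) =
     lin_eval (\<lambda>us. coefH d g (us ! 0 \<otimes>\<^bsub>H\<^esub> conv (Suc n) (us ! 1))) (rep (comult H X))"
proof -
  have "coefH d g (conv (Suc (Suc n)) X) = lin_eval (\<lambda>us. coefH d g (tprod us)) (iter_rep n X)"
    unfolding conv_def iterated_comult.simps iter_rep_def[symmetric]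
    by (rule tensor_mult_class(2)[OF iterated_comult_formal(2) linear_coefH])
  also have "\<dots> = lin_eval (\<lambda>us. lin_eval (\<lambda>ws. coefH d g (us ! 0 \<otimes>\<^bsub>H\<^esub> tprod ws))
      (rep (iterated_comult H (Suc n) (us ! 1)))) (rep (comult H X))"
    by (simp add: iter_rep_def)
  also have "\<dots> = lin_eval (\<lambda>us. coefH d g (us ! 0 \<otimes>\<^bsub>H\<^esub> conv (Suc n) (us ! 1))) (rep (comult H X))"
  proof (rule lin_eval_cong)
    fix us assume "us \<in> Poly_Mapping.keys (rep (comult H X))"
    then have us: "length us = 2 \<and> set us \<subseteq> carrier H"
      using rep_tensor_class(1)[OF comult_rep_formal, of X]
      by (auto simp: comult_H formal_tensors_def carrier_A)
    then have u: "us ! 0 \<in> carrier H" "us ! 1 \<in> carrier H" by (auto simp: subset_iff)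
    have lin: "linear_H (\<lambda>Y. coefH d g (us ! 0 \<otimes>\<^bsub>H\<^esub> Y))"
      using linear_coefH_mult[of d g "rep (us ! 0)"] by (simp add: cls_rep u)
    obtain s where s: "s \<in> formal_tensors H (Suc n)"
      "iterated_comult H (Suc n) (us ! 1) = tensor_class H (Suc n) s"
      using iterated_comult_formal(1)[OF u(2)] by blast
    show "lin_eval (\<lambda>ws. coefH d g (us ! 0 \<otimes>\<^bsub>H\<^esub> tprod ws)) (rep (iterated_comult H (Suc n) (us ! 1)))
        = coefH d g (us ! 0 \<otimes>\<^bsub>H\<^esub> conv (Suc n) (us ! 1))"
      unfolding conv_def s(2) tensor_mult_class(2)[OF s(1) lin]
      using lin_eval_tprod_null[OF rep_tensor_class(2)[OF s(1)] lin] by simp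
  qed
  finally show ?thesis .
qed

text \<open>The alternating product of \<open>h\<close> and \<open>bar d h\<close> with
  \<open>n\<close> factors, as \<open>bar d\<close> is an involution. It is the value of the summand
  of the iterated comultiplication all of whose factors have type \<open>d\<close>.\<close>

fun twisted_power :: "nat \<Rightarrow> bit \<Rightarrow> int \<times> int \<Rightarrow> int \<times> int" where
  "twisted_power 0 d h = (0, 0)"
| "twisted_power (Suc n) d h = kmult h (twisted_power n d (bar d h))"

text \<open>The types of the tensor factors add up to the type of the word, so \<open>n\<close>
  factors of type \<open>d\<close> come only from words of this type.\<close>

fun tdeg :: "nat \<Rightarrow> bit \<Rightarrow> bit" where
  "tdeg 0 d = 0"
| "tdeg (Suc n) d = d + tdeg n d"

lemma wt_tdeg: "wt (tdeg n d) = sign_pow (wt d) (int n)" "vt (tdeg n d) = sign_pow (vt d) (int n)"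
proof (induction n)
  case 0
  { case 1 show ?case by (simp add: wt_def sign_pow_def) }
  { case 2 show ?case by (simp add: vt_def sign_pow_def) }
next
  case (Suc n)
  { case 1 show ?case using Suc(1) by (simp only: tdeg.simps wt_vt_add of_nat_Suc) (auto simp: sign_pow_def) }
  { case 2 show ?case using Suc(2) by (simp only: tdeg.simps wt_vt_add of_nat_Suc) (auto simp: sign_pow_def) }
qed

lemma twisted_power_shift1:
  "twisted_power n d (s + 2 * int N, r) =
    (fst (twisted_power n d (s, r)) + 2 * int N * int n, snd (twisted_power n d (s, r)))"
proof (induction n arbitrary: r)
  case (Suc n)
  have "bar d (s + 2 * int N, r) = (s + 2 * int N, snd (bar d (s, r)))" "bar d (s, r) = (s, snd (bar d (s, r)))"
    by (simp_all add: bar_def)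
  then show ?case
    using Suc[of "snd (bar d (s, r))"] by (simp add: kmult_def mult.assoc) (simp add: algebra_simps)
qed simp

text \<open>Each of the \<open>n\<close> factors contributes \<open>k\<close> or \<open>- k\<close>,
  so \<open>m\<close> has the parity of \<open>n\<close>. All odd \<open>k\<close> are allowed since
  \<open>bar\<close> changes the sign of \<open>k\<close> during the induction.\<close>

lemma twisted_power_shift2:
  assumes "odd k"
  shows "\<exists>m. (even m \<longleftrightarrow> even n) \<and> twisted_power n d (s, r + int L * k) =
    (fst (twisted_power n d (s, r)), snd (twisted_power n d (s, r)) + int L * m)"
  using assms
proof (induction n arbitrary: r k)
  case 0
  then show ?case by (intro exI[of _ 0]) simp
next
  case (Suc n)
  define k' where "k' = (if d = 0 then k else - k)"
  define r' where "r' = snd (bar d (s, r))"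
  have bar: "bar d (s, r + int L * k) = (s, r' + int L * k')" "bar d (s, r) = (s, r')"
    by (simp_all add: bar_def k'_def r'_def)
  have "odd k'" using Suc.prems by (simp add: k'_def)
  from Suc.IH[OF this, of r'] obtain m where m: "even m \<longleftrightarrow> even n"
    "twisted_power n d (s, r' + int L * k') =
      (fst (twisted_power n d (s, r')), snd (twisted_power n d (s, r')) + int L * m)" by blast
  let ?S = "sign_int (fst (twisted_power n d (s, r')))"
  have "odd (?S * k)" using Suc.prems by (simp add: sign_int_def)
  with m(1) have "even (?S * k + m) \<longleftrightarrow> even (Suc n)" by simp
  moreover have "twisted_power (Suc n) d (s, r + int L * k) =
    (fst (twisted_power (Suc n) d (s, r)), snd (twisted_power (Suc n) d (s, r)) + int L * (?S * k + m))"
    by (simp add: bar m(2) kmult_def) (simp add: algebra_simps)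
  ultimately show ?case by blast
qed

lemma twisted_power_quasi_periodic:
  "quasi_periodic (tdeg n d) (\<lambda>h. tau d (kmult g (twisted_power n d h)))"
  unfolding quasi_periodic_def
proof (intro conjI allI)
  fix s r
  let ?p = "twisted_power n d (s, r)"
  note q = quasi_periodic_kmult[OF tau_quasi_periodic[of d], where h = "(0, 0)" and g = g, unfolded kmult_one(2)]
  show "tau d (kmult g (twisted_power n d (s + 2 * int N, r))) = wt (tdeg n d) * tau d (kmult g ?p)"
    using q[of "fst ?p" "int n" "snd ?p" 0] by (simp add: twisted_power_shift1 wt_tdeg sign_pow_def)
  obtain m where m: "even m \<longleftrightarrow> even n" "twisted_power n d (s, r + int L * 1) = (fst ?p, snd ?p + int L * m)"
    using twisted_power_shift2[OF odd_one, of n d s r] by blast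
  then show "tau d (kmult g (twisted_power n d (s, r + int L))) = vt (tdeg n d) * tau d (kmult g ?p)"
    using q[of "fst ?p" 0 "snd ?p" m] by (simp add: wt_tdeg sign_pow_def)
qed

text \<open>Induction by \<open>conv_step\<close>: since the types 0 and 1 annihilate each other,
  only the part of the comultiplication with left type \<open>d\<close> and right type
  \<open>tdeg (Suc n) d\<close> contributes.\<close>

lemma coefH_conv:
  "coefH d g (conv (Suc n) (cls f)) =
     lin_eval (pure_eval (tdeg (Suc n) d) (\<lambda>h. tau d (kmult g (twisted_power (Suc n) d h)))) f"
proof (induction n arbitrary: d g f)
  case 0
  then show ?case by (simp add: conv_1 coef_def)
next
  case (Suc n)
  let ?P = "conv (Suc n)"
  have P: "?P X \<in> carrier H" if "X \<in> carrier H" for X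
    using that by (rule conv_closed)
  \<comment> \<open>Additivity of the Sweedler power is read off from the induction hypothesis,
    whose right-hand side is linear in \<open>f\<close>, because \<open>coefH\<close> separates
    elements.\<close>
  have P_add: "?P (X \<oplus>\<^bsub>H\<^esub> Y) = ?P X \<oplus>\<^bsub>H\<^esub> ?P Y" if XY: "X \<in> carrier H" "Y \<in> carrier H" for X Y
  proof -
    obtain p q where pq: "X = cls p" "Y = cls q" using XY by (auto elim!: carrierE)
    show ?thesis
      by (rule coefH_eqI) (use XY P in \<open>auto simp: linear_H_add[OF linear_coefH] pq Suc\<close>)
  qed
  have P_smult: "?P (c \<odot>\<^bsub>H\<^esub> X) = c \<odot>\<^bsub>H\<^esub> ?P X" if X: "X \<in> carrier H" for X c
  proof -
    obtain p where p: "X = cls p" using X by (auto elim!: carrierE)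
    show ?thesis
      by (rule coefH_eqI) (use X P in \<open>auto simp: linear_H_smult[OF linear_coefH] p Suc\<close>)
  qed
  let ?B = "\<lambda>us. coefH d g (us ! 0 \<otimes>\<^bsub>H\<^esub> ?P (us ! 1))"
  \<comment> \<open>\<open>?B\<close> is bilinear, so any representative of the comultiplication may
    be replaced by \<open>comult_rep\<close>.\<close>
  have null: "lin_eval ?B s = 0" if "s \<in> tensor_null A 2" for s
    using that
  proof (rule lin_eval_tensor_null)
    fix us ws a b
    assume *: "set us \<subseteq> carrier A" "set ws \<subseteq> carrier A" "a \<in> carrier A" "b \<in> carrier A"
      "length us + 1 + length ws = 2"
    then consider x where "us = []" "ws = [x]" "x \<in> carrier H" | x where "us = [x]" "ws = []" "x \<in> carrier H"
      unfolding carrier_A by (cases us; cases ws) auto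
    then show "?B (us @ [a \<oplus>\<^bsub>A\<^esub> b] @ ws) = ?B (us @ [a] @ ws) + ?B (us @ [b] @ ws)"
      by cases (use * in \<open>simp_all add: carrier_A A_ops P P_add HR.l_distr HR.r_distr linear_H_add[OF linear_coefH]\<close>)
  next
    fix us ws a k
    assume *: "set us \<subseteq> carrier A" "set ws \<subseteq> carrier A" "a \<in> carrier A"
      "length us + 1 + length ws = 2"
    then consider x where "us = []" "ws = [x]" "x \<in> carrier H" | x where "us = [x]" "ws = []" "x \<in> carrier H"
      unfolding carrier_A by (cases us; cases ws) auto
    then show "?B (us @ [k \<odot>\<^bsub>A\<^esub> a] @ ws) = k * ?B (us @ [a] @ ws)"
      by cases (use * in \<open>simp_all add: carrier_A A_ops P P_smult smult_mult linear_H_smult[OF linear_coefH]\<close>)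
  qed
  let ?t = "tdeg (Suc n) d"
  let ?\<psi> = "\<lambda>h. tau d (kmult g (twisted_power (Suc (Suc n)) d h))"
  have "coefH d g (conv (Suc (Suc n)) (cls f)) = lin_eval ?B (rep (comult H (cls f)))"
    by (rule conv_step)
  also have "\<dots> = lin_eval ?B (comult_rep (cls f))"
    using null[OF rep_tensor_class(2)[OF comult_rep_formal]] by (simp add: comult_H)
  also have "\<dots> = lin_eval (\<lambda>(u, v). coefH d g (cls (Poly_Mapping.single u 1) \<otimes>\<^bsub>H\<^esub> ?P (cls (Poly_Mapping.single v 1))))
      (free_comult (rep (cls f)))"
    by (simp add: comult_rep_def case_prod_unfold)
  also have "\<dots> = lin_eval (\<lambda>(u, v). if pure d u \<and> pure ?t v
      then tau d (kmult g (kmult (gval u) (twisted_power (Suc n) d (gval v)))) else 0) (free_comult (rep (cls f)))"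
  proof (rule lin_eval_cong, clarify)
    fix u v
    obtain q where q: "?P (cls (Poly_Mapping.single v 1)) = cls q"
      using P[OF cls_carrier, of "Poly_Mapping.single v 1"] by (auto elim: carrierE)
    have "coefH d g (cls (Poly_Mapping.single u 1) \<otimes>\<^bsub>H\<^esub> ?P (cls (Poly_Mapping.single v 1)))
      = (if pure d u then coefH d (kmult g (gval u)) (?P (cls (Poly_Mapping.single v 1))) else 0)"
      by (simp add: q coef_mult_left pure_eval_def)
    also have "\<dots> = (if pure d u \<and> pure ?t v
      then tau d (kmult g (kmult (gval u) (twisted_power (Suc n) d (gval v)))) else 0)"
      unfolding Suc by (simp add: pure_eval_def kmult_assoc)
    finally show "coefH d g (cls (Poly_Mapping.single u 1) \<otimes>\<^bsub>H\<^esub> ?P (cls (Poly_Mapping.single v 1)))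
      = (if pure d u \<and> pure ?t v
      then tau d (kmult g (kmult (gval u) (twisted_power (Suc n) d (gval v)))) else 0)" .
  qed
  also have "\<dots> = lin_eval (pure_eval (tdeg (Suc (Suc n)) d) ?\<psi>) (rep (cls f))"
    unfolding lin_eval_free_comult_pure[where F = "\<lambda>a b. tau d (kmult g (kmult a (twisted_power (Suc n) d b)))"]
    by (simp only: pure_eval_def[abs_def] tdeg.simps twisted_power.simps)
  \<comment> \<open>Quasi-periodicity of the twisted power removes the representative of the class
    of \<open>f\<close>.\<close>
  also have "\<dots> = lin_eval (pure_eval (tdeg (Suc (Suc n)) d) ?\<psi>) f"
    using quasi_periodic_ker[OF twisted_power_quasi_periodic, of "rep (cls f) - f" "Suc (Suc n)" d g] rep_cls[of f]
    by (simp add: eqv_def del: tdeg.simps twisted_power.simps)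
  finally show ?case .
qed

text \<open>For \<open>d = 0\<close> the number of solutions of g^n = 1 in the group of order 2NL;
  for \<open>d = 1\<close> and even \<open>n\<close> the signed count.\<close>

definition power_sum :: "nat \<Rightarrow> bit \<Rightarrow> complex" where
  "power_sum n d = (\<Sum>s\<in>{1..2 * N}. \<Sum>r<L. tau d (twisted_power n d (nword_val s r)))"

text \<open>The factor 2NL of the regular character cancels the normalization of
  \<open>haar\<close>. As \<open>haar\<close> has type 0, type \<open>d\<close> contributes only if
  \<open>tdeg n d = 0\<close>.\<close>

lemma fs_indicator_eq:
  assumes "n \<ge> 1"
  shows "fs_indicator n H = power_sum n 0 + of_bool (even n) * power_sum n 1"
proof -
  obtain m where m: "n = Suc m" using assms by (cases n) auto
  have tdeg: "tdeg k 0 = 0" "tdeg k 1 = of_bool (odd k)" for k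
    by (induction k) auto
  obtain f where f: "conv n (cls haar) = cls f"
    using conv_closed[of "cls haar" m, OF cls_carrier] unfolding m by (auto elim: carrierE)
  have coef: "coef d (0, 0) f = (if tdeg n d = 0 then power_sum n d / of_nat (2 * N * L) else 0)" for d
    using coefH_conv[of d "(0, 0)" m haar]
    unfolding m[symmetric] f lin_eval_haar by (simp add: power_sum_def)
  have "fs_indicator n H = regular_character H (conv n (cls haar))"
    by (simp add: fs_indicator_def normalized_integral_H conv_def)
  also have "\<dots> = of_nat (2 * N * L) * (coef 0 (0, 0) f + coef 1 (0, 0) f)"
    by (simp only: f regular_character_cls)
  also have "\<dots> = power_sum n 0 + of_bool (even n) * power_sum n 1"
    unfolding coef tdeg using N_pos L_ge by (simp add: distrib_left)
  finally show ?thesis .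
qed

end

section \<open>Counting\<close>

text \<open>The analogue of \<open>tau\<close> for a cyclic group: the coefficient of the unit in
  the algebra with one generator t and t^M = \<open>\<kappa>\<close>.\<close>

definition chi :: "nat \<Rightarrow> complex \<Rightarrow> int \<Rightarrow> complex" where
  "chi M \<kappa> x = (if int M dvd x then sign_pow \<kappa> (x div int M) else 0)"

lemma chi_minus: "chi M \<kappa> (- x) = chi M \<kappa> x"
  by (auto simp: chi_def sign_pow_def dvd_neg_div)

lemma chi_cancel: "g > 0 \<Longrightarrow> chi (g * m) \<kappa> (int g * x) = chi m \<kappa> x"
  by (simp add: chi_def)

lemma sum_dvd_lessThan:
  fixes \<phi> :: "nat \<Rightarrow> complex"
  assumes "m > 0"
  shows "(\<Sum>j<g * m. if m dvd j then \<phi> j else 0) = (\<Sum>i<g. \<phi> (m * i))"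
proof -
  have "(\<Sum>j<g * m. if m dvd j then \<phi> j else 0) = (\<Sum>j\<in>(\<lambda>i. m * i) ` {..<g}. \<phi> j)"
    using assms by (intro sum.mono_neutral_cong_right) (auto simp: mult.commute)
  also have "\<dots> = (\<Sum>i<g. \<phi> (m * i))"
    using assms by (subst sum.reindex) (auto simp: inj_on_def)
  finally show ?thesis .
qed

lemma b2_mult: "m > 0 \<Longrightarrow> n > 0 \<Longrightarrow> b2 (m * n) = b2 m + b2 n"
  by (simp add: b2_def prime_elem_multiplicity_mult_distrib)

lemma b2_eq_0_iff: "m > 0 \<Longrightarrow> b2 m = 0 \<longleftrightarrow> odd m"
  by (auto simp: b2_def multiplicity_eq_zero_iff)

lemma b2_nonneg [simp]: "b2 m \<ge> 0"
  by (simp add: b2_def)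

lemma b2_double: "h > 0 \<Longrightarrow> b2 (2 * h) = b2 h + 1"
  by (simp add: b2_mult) (simp add: b2_def)

lemma gcd_decompose:
  assumes "M > 0" "n > 0"
  obtains g m n' :: nat where "gcd M n = g" "M = g * m" "n = g * n'" "coprime m n'"
    "g > 0" "m > 0" "n' > 0" "b2 M = b2 g + b2 m" "b2 n = b2 g + b2 n'"
proof -
  have "gcd M n \<noteq> 0" using assms by simp
  from gcd_coprime_exists[OF this] obtain m n' where *: "M = m * gcd M n" "n = n' * gcd M n" "coprime m n'"
    by blast
  obtain g where g: "gcd M n = g" by blast
  have "M = g * m" "n = g * n'" using *(1,2) unfolding g by (simp_all add: mult.commute)
  moreover from this have "g > 0" "m > 0" "n' > 0" using assms by auto
  ultimately show ?thesis using that[of g m n'] g *(3) by (simp add: b2_mult)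
qed

text \<open>Write M = g m and n = g n' with g the gcd. As m and n' are coprime, only the multiples j
  = m i contribute, each with the sign for n' i.\<close>

lemma sum_chi:
  assumes "M > 0" "n > 0"
  shows "(\<Sum>j<M. chi M \<kappa> (int n * int j)) = (\<Sum>i<gcd M n. sign_pow \<kappa> (int (n div gcd M n) * int i))"
proof -
  obtain g m n' where gcd: "gcd M n = g" and M: "M = g * m" and n: "n = g * n'" and "coprime m n'"
    and pos: "g > 0" "m > 0"
    using gcd_decompose[OF assms] by metis
  have chi: "chi M \<kappa> (int n * int j) = chi m \<kappa> (int n' * int j)" for j
    unfolding M n of_nat_mult mult.assoc by (rule chi_cancel[OF pos(1)])
  have "chi m \<kappa> (int n' * int j) = (if m dvd j then chi m \<kappa> (int n' * int j) else 0)" for j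
    using \<open>coprime m n'\<close> by (simp add: chi_def coprime_dvd_mult_right_iff flip: of_nat_mult)
  then have "(\<Sum>j<M. chi M \<kappa> (int n * int j)) = (\<Sum>j<g * m. if m dvd j then chi m \<kappa> (int n' * int j) else 0)"
    unfolding chi by (simp only: M)
  also have "\<dots> = (\<Sum>i<g. chi m \<kappa> (int n' * int (m * i)))"
    by (rule sum_dvd_lessThan[OF pos(2)])
  also have "\<dots> = (\<Sum>i<g. sign_pow \<kappa> (int n' * int i))"
  proof (rule sum.cong[OF refl])
    fix i
    have "chi m \<kappa> (int n' * int (m * i)) = chi (m * 1) \<kappa> (int m * (int n' * int i))"
      by (simp add: algebra_simps)
    also have "\<dots> = chi 1 \<kappa> (int n' * int i)"
      by (rule chi_cancel[OF pos(2)])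
    finally show "chi m \<kappa> (int n' * int (m * i)) = sign_pow \<kappa> (int n' * int i)" by (simp add: chi_def)
  qed
  also have "n' = n div g" using pos by (simp add: n)
  finally show ?thesis by (simp only: gcd)
qed

lemma sign_pow_1 [simp]: "sign_pow 1 x = 1"
  by (simp add: sign_pow_def)

lemma sum_chi_1: "M > 0 \<Longrightarrow> n > 0 \<Longrightarrow> (\<Sum>j<M. chi M 1 (int n * int j)) = of_nat (gcd M n)"
  by (simp add: sum_chi)

lemma sum_sign_pow_even: "even g \<Longrightarrow> odd k \<Longrightarrow> (\<Sum>i<g. sign_pow (- 1) (k * int i)) = 0"
proof -
  assume "even g" "odd k"
  then obtain q where "g = 2 * q" by blast
  moreover have "(\<Sum>i<2 * q. sign_pow (- 1) (k * int i)) = 0"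
    using \<open>odd k\<close> by (induction q) (auto simp: sign_pow_def)
  ultimately show ?thesis by simp
qed

text \<open>If n' is even, all g signs are 1, and m is odd, so 2 divides n more often than M. If n'
  is odd, g is even and the alternating signs cancel.\<close>

lemma sum_chi_minus_1:
  assumes "M > 0" "n > 0" "even n"
  shows "(\<Sum>j<M. chi M (- 1) (int n * int j)) = of_bool (b2 n - 1 \<ge> b2 M) * of_nat (gcd M n)"
proof -
  obtain g m n' where gcd: "gcd M n = g" and n: "n = g * n'" and "coprime m n'"
    and pos: "g > 0" "m > 0" "n' > 0" and b2: "b2 M = b2 g + b2 m" "b2 n = b2 g + b2 n'"
    using gcd_decompose[OF assms(1,2)] by metis
  have sum: "(\<Sum>j<M. chi M (- 1) (int n * int j)) = (\<Sum>i<g. sign_pow (- 1) (int n' * int i))"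
    using sum_chi[OF assms(1,2)] pos unfolding gcd by (simp add: n)
  show ?thesis
  proof (cases "even n'")
    case True
    then have "odd m" using \<open>coprime m n'\<close> by (meson coprime_common_divisor odd_one)
    then have "b2 m = 0" using pos by (simp add: b2_eq_0_iff)
    moreover have "b2 n' > 0" using True b2_eq_0_iff[OF pos(3)] b2_nonneg[of n'] by linarith
    ultimately have "b2 n - 1 \<ge> b2 M" using b2 by linarith
    with True show ?thesis unfolding sum gcd by (simp add: sign_pow_def)
  next
    case False
    then have "b2 n' = 0" using pos by (simp add: b2_eq_0_iff)
    then have "\<not> b2 n - 1 \<ge> b2 M" using b2 b2_nonneg[of m] by linarith
    moreover have "even g" using n False assms(3) by simp
    ultimately show ?thesis using False
      unfolding sum gcd by (simp add: sum_sign_pow_even)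
  qed
qed

text \<open>Write M = g m and h = g h' with g = gcd M h. A solution needs m to divide an odd number,
  so m is odd; then g values of j remain, each with sign \<open>\<kappa>\<close> to the power h',
  since the quotient of two odd numbers is odd.\<close>

lemma sum_chi_odd:
  assumes "M > 0" "h > 0"
  shows "(\<Sum>j<M. chi M \<kappa> (int h * (2 * int j + 1))) =
     of_bool (b2 (2 * h) - 1 \<ge> b2 M) * \<kappa> ^ of_bool (b2 (2 * h) = b2 M + 1) * of_nat (gcd M (2 * h))"
proof -
  obtain g m h' where M: "M = g * m" and h: "h = g * h'" and "coprime m h'"
    and pos: "g > 0" "m > 0" "h' > 0" and b2: "b2 M = b2 g + b2 m" "b2 h = b2 g + b2 h'"
    using gcd_decompose[OF assms] by metis
  have chi: "chi M \<kappa> (int h * x) = (if int m dvd x then sign_pow \<kappa> (int h' * (x div int m)) else 0)" for x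
  proof -
    have "chi M \<kappa> (int h * x) = chi m \<kappa> (int h' * x)"
      unfolding M h of_nat_mult mult.assoc by (rule chi_cancel[OF pos(1)])
    also have "\<dots> = (if int m dvd x then sign_pow \<kappa> (int h' * (x div int m)) else 0)"
      using \<open>coprime m h'\<close> by (simp add: chi_def coprime_dvd_mult_right_iff div_mult_swap)
    finally show ?thesis .
  qed
  show ?thesis
  proof (cases "even m")
    case True
    then have "b2 m > 0" using b2_eq_0_iff[OF pos(2)] b2_nonneg[of m] by linarith
    moreover have "odd h'" using True \<open>coprime m h'\<close> by (meson coprime_common_divisor odd_one)
    then have "b2 h' = 0" using pos by (simp add: b2_eq_0_iff)
    ultimately have "\<not> b2 (2 * h) - 1 \<ge> b2 M" using b2 b2_double[OF assms(2)] by linarith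
    moreover have "\<not> int m dvd 2 * int j + 1" for j
    proof
      assume "int m dvd 2 * int j + 1"
      moreover have "2 dvd int m" using True by simp
      ultimately have "2 dvd 2 * int j + 1" by (rule dvd_trans[rotated])
      then show False by simp
    qed
    ultimately show ?thesis by (simp add: chi)
  next
    case False
    then obtain q where q: "m = 2 * q + 1" by (elim oddE)
    have b2m: "b2 m = 0" using False pos by (simp add: b2_eq_0_iff)
    have cond: "b2 (2 * h) - 1 \<ge> b2 M"
      using b2 b2m b2_double[OF assms(2)] b2_nonneg[of h'] by linarith
    have cond': "b2 (2 * h) = b2 M + 1 \<longleftrightarrow> odd h'"
      using b2 b2m b2_double[OF assms(2)] b2_eq_0_iff[OF pos(3)] by linarith
    \<comment> \<open>Doubling \<open>h\<close> does not enlarge the gcd because \<open>m\<close> is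
      odd.\<close>
    have gcd: "gcd M (2 * h) = g"
    proof -
      have "gcd M (2 * h) = gcd (g * m) (g * (2 * h'))"
        unfolding M h by (simp only: mult.left_commute)
      also have "\<dots> = g * gcd m (2 * h')" by (simp add: gcd_mult_distrib_nat)
      also have "coprime m (2 * h')" using \<open>coprime m h'\<close> False by simp
      then have "gcd m (2 * h') = 1" by simp
      finally show ?thesis by simp
    qed
    \<comment> \<open>With \<open>m = 2 * q + 1\<close> the odd number is 2 (j - q) + m, and 2 is
      invertible modulo \<open>m\<close>; the condition is periodic in j.\<close>
    have dvd: "int m dvd 2 * int j + 1 \<longleftrightarrow> int m dvd int j + (- int q)" for j
    proof -
      have "2 * int j + 1 = 2 * (int j + (- int q)) + int m" by (simp add: q)
      then have "int m dvd 2 * int j + 1 \<longleftrightarrow> int m dvd 2 * (int j + (- int q))"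
        by (simp only: dvd_add_left_iff[OF dvd_refl])
      also have "\<dots> \<longleftrightarrow> int m dvd int j + (- int q)"
        by (rule coprime_dvd_mult_right_iff) (use False in simp)
      finally show ?thesis .
    qed
    have sign_pow: "sign_pow \<kappa> (int h' * (x div int m)) = sign_pow \<kappa> (int h')" if x: "int m dvd x" "odd x" for x
    proof -
      obtain k where k: "x = int m * k" using x(1) by (rule dvdE)
      with x(2) have "odd k" by simp
      with k pos show ?thesis by (simp add: sign_pow_def)
    qed
    have "chi M \<kappa> (int h * (2 * int j + 1)) =
        sign_pow \<kappa> (int h') * of_bool (int m dvd int j + (- int q))" for j
      unfolding chi using sign_pow[of "2 * int j + 1"] by (simp add: dvd)
    then have "(\<Sum>j<M. chi M \<kappa> (int h * (2 * int j + 1))) =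
        sign_pow \<kappa> (int h') * (\<Sum>j<M. of_bool (int m dvd int j + (- int q)))"
      by (simp only: sum_distrib_left)
    also have "(\<Sum>j<M. of_bool (int m dvd int j + (- int q))) = (\<Sum>j<M. of_bool (int m dvd int j) :: complex)"
    proof (rule periodic_sum)
      fix x
      show "of_bool (int m dvd x + int M) = (of_bool (int m dvd x) :: complex)"
        unfolding M by (simp add: dvd_add_left_iff)
    qed
    also have "\<dots> = (\<Sum>j<g * m. if m dvd j then 1 else 0)"
      by (simp add: M of_bool_def)
    also have "\<dots> = of_nat g" by (simp add: sum_dvd_lessThan[OF pos(2)])
    finally show ?thesis
      unfolding gcd using cond cond' by (auto simp: sign_pow_def)
  qed
qed

lemma sum_even_odd:
  fixes G :: "nat \<Rightarrow> complex"
  shows "(\<Sum>s<2 * M. G s) = (\<Sum>j<M. G (2 * j)) + (\<Sum>j<M. G (2 * j + 1))"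
  by (induction M) (auto simp: algebra_simps)

context suzuki
begin

section \<open>Evaluation of the two power sums\<close>

lemma tau_eq_chi: "tau d (2 * x, y) = chi N (wt d) x * chi L (vt d) y"
  by (simp add: tau_def chi_def)

lemma twisted_power_0:
  "twisted_power n 0 (s, r) = (int n * s, if even s then int n * r else if odd n then r else 0)"
  by (induction n) (auto simp: bar_def kmult_def sign_int_def algebra_simps)

text \<open>The product of g = x^s v^r and \<open>bar 1\<close> of it is x^(2s) for even
  \<open>s\<close> and x^(2s) v^(-2r-1) for odd \<open>s\<close>. Its h-th power is immediate
  because x^(2s) is central.\<close>

lemma twisted_power_1:
  "twisted_power (2 * h) 1 (s, r) = (int (2 * h) * s, if even s then 0 else - (int h * (2 * r + 1)))"
proof (induction h)
  case (Suc h)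
  have "twisted_power (2 * Suc h) 1 (s, r) =
      kmult (s, r) (kmult (bar 1 (s, r)) (twisted_power (2 * h) 1 (bar 1 (bar 1 (s, r)))))"
    by simp
  also have "bar 1 (bar 1 (s, r)) = (s, r)" by (simp add: bar_def)
  finally show ?case using Suc
    by (simp add: bar_def kmult_def sign_int_def algebra_simps)
qed simp

text \<open>For fixed \<open>r\<close> the shift of the x-exponent by \<open>2 * r\<close> is undone
  by periodicity, which holds without a sign as the total type is 0. The sum is then split by the
  parity of the x-exponent.\<close>

lemma power_sum_eq:
  assumes "tdeg n d = 0"
  shows "power_sum n d = (\<Sum>j<N. \<Sum>r<L. tau d (twisted_power n d (2 * int j, int r)))
      + (\<Sum>j<N. \<Sum>r<L. tau d (twisted_power n d (2 * int j + 1, int r)))"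
proof -
  have per: "tau d (twisted_power n d (x + int (2 * N), y)) = tau d (twisted_power n d (x, y))" for x y
    using twisted_power_quasi_periodic[of n d "(0, 0)"] assms
    by (simp add: quasi_periodic_def wt_def)
  have "power_sum n d = (\<Sum>r<L. \<Sum>s\<in>{1..2 * N}. tau d (twisted_power n d (int s + 2 * int r, int r)))"
    unfolding power_sum_def by (rule sum.swap)
  also have "\<dots> = (\<Sum>r<L. \<Sum>s<2 * N. tau d (twisted_power n d (int s, int r)))"
    by (rule sum.cong[OF refl],
        rule periodic_sum_atLeast1[where F = "\<lambda>x. tau d (twisted_power n d (x, int r))" for r])
      (rule per)
  also have "\<dots> = (\<Sum>s<2 * N. \<Sum>r<L. tau d (twisted_power n d (int s, int r)))"
    by (rule sum.swap)
  finally show ?thesis by (simp add: sum_even_odd add.commute[of 1])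
qed

lemma wt_vt_simps [simp]: "wt 0 = 1" "vt 0 = 1" "wt 1 = \<alpha>" "vt 1 = \<beta>"
  by (simp_all add: wt_def vt_def)

lemma chi_0 [simp]: "chi M \<kappa> 0 = 1"
  by (simp add: chi_def sign_pow_def)

lemma power_sum_0_even_part:
  assumes "n > 0"
  shows "(\<Sum>j<N. \<Sum>r<L. tau 0 (twisted_power n 0 (2 * int j, int r))) = of_nat (gcd N n * gcd L n)"
proof -
  have "tau 0 (twisted_power n 0 (2 * int j, int r)) = chi N 1 (int n * int j) * chi L 1 (int n * int r)" for j r
    using tau_eq_chi[of 0 "int n * int j" "int n * int r"]
    by (simp add: twisted_power_0 algebra_simps)
  then have "(\<Sum>j<N. \<Sum>r<L. tau 0 (twisted_power n 0 (2 * int j, int r)))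
     = (\<Sum>j<N. chi N 1 (int n * int j)) * (\<Sum>r<L. chi L 1 (int n * int r))"
    by (simp add: sum_product)
  then show ?thesis using assms N_pos L_ge by (simp add: sum_chi_1)
qed

text \<open>For even x-exponent the conditions on x and v are independent. For odd x-exponent and
  even \<open>n\<close> the v-part of the power vanishes, so every \<open>r\<close> counts; for odd
  \<open>n\<close> the power has odd x-exponent and is never the unit.\<close>

lemma power_sum_0:
  assumes "n > 0"
  shows "power_sum n 0 = of_nat (gcd N n * gcd L n)
     + of_nat L * of_bool (b2 n - 1 \<ge> b2 N) * of_nat (gcd N n)"
proof -
  have "tdeg n 0 = 0" by (induction n) auto
  note sum = power_sum_eq[OF this, unfolded power_sum_0_even_part[OF assms]]
  show ?thesis
  proof (cases "even n")
    case True
    then obtain h where h: "n = 2 * h" by blast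
    have "tau 0 (twisted_power n 0 (2 * int j + 1, int r)) = chi N 1 (int h * (2 * int j + 1))" for j r
      using tau_eq_chi[of 0 "int h * (2 * int j + 1)" 0]
      by (simp add: twisted_power_0 h mult.assoc)
    then have "(\<Sum>j<N. \<Sum>r<L. tau 0 (twisted_power n 0 (2 * int j + 1, int r)))
       = of_nat L * (\<Sum>j<N. chi N 1 (int h * (2 * int j + 1)))"
      by (simp add: sum_distrib_left)
    then show ?thesis
      using sum assms N_pos sum_chi_odd[of N h 1] by (simp add: h)
  next
    case False
    have "tau 0 (twisted_power n 0 (2 * int j + 1, int r)) = 0" for j r
    proof -
      have "odd (int n * (2 * int j + 1))" using False by simp
      then have "\<not> 2 * int N dvd int n * (2 * int j + 1)" by (meson dvd_mult_left)
      then show ?thesis by (simp add: twisted_power_0 tau_def)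
    qed
    moreover have "b2 n = 0" using False assms by (simp add: b2_eq_0_iff)
    then have "\<not> b2 n - 1 \<ge> b2 N" using b2_nonneg[of N] by linarith
    ultimately show ?thesis using sum by simp
  qed
qed

text \<open>The first summand comes from even x-exponents, where the v-part cancels; the second from
  odd ones, where the sum is a product of two sums as in \<open>sum_chi_odd\<close>.\<close>

lemma power_sum_1:
  assumes "n > 0" "even n" and "\<not> (even N \<and> \<alpha> = 1)"
  shows "power_sum n 1 = of_nat L * of_bool (b2 n - 1 \<ge> b2 N) * of_nat (gcd N n)
     + (of_bool (b2 n - 1 \<ge> b2 N) * \<alpha> ^ of_bool (b2 n = b2 N + 1) * of_nat (gcd N n))
     * (of_bool (b2 n - 1 \<ge> b2 L) * \<beta> ^ of_bool (b2 n = b2 L + 1) * of_nat (gcd L n))"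
proof -
  obtain h where h: "n = 2 * h" using assms(2) by blast
  have "h > 0" using assms(1) h by simp
  have "tdeg (2 * h) 1 = 0" by (induction h) auto
  note sum = power_sum_eq[OF this]
  have "tau 1 (twisted_power (2 * h) 1 (2 * int j, int r)) = chi N \<alpha> (int n * int j)" for j r
    using tau_eq_chi[of 1 "int n * int j" 0]
    unfolding twisted_power_1 by (simp add: h algebra_simps)
  then have "(\<Sum>j<N. \<Sum>r<L. tau 1 (twisted_power (2 * h) 1 (2 * int j, int r)))
      = of_nat L * (\<Sum>j<N. chi N \<alpha> (int n * int j))"
    by (simp add: sum_distrib_left)
  also have "(\<Sum>j<N. chi N \<alpha> (int n * int j)) = of_bool (b2 n - 1 \<ge> b2 N) * of_nat (gcd N n)"
  \<comment> \<open>For \<open>\<alpha> = 1\<close> the sum is \<open>gcd N n\<close>; the excluded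
    case makes \<open>N\<close> odd, and since \<open>n\<close> is even the bracket is 1.\<close>
  proof (cases "\<alpha> = 1")
    case True
    then have "b2 N = 0" using assms(3) N_pos by (simp add: b2_eq_0_iff)
    moreover have "b2 n \<ge> 1" using b2_double[OF \<open>h > 0\<close>] b2_nonneg[of h] unfolding h by linarith
    ultimately show ?thesis using True assms(1) N_pos by (simp add: sum_chi_1)
  next
    case False
    then have "\<alpha> = - 1" using alpha by simp
    then show ?thesis using sum_chi_minus_1[of N n] assms N_pos by simp
  qed
  finally have even: "(\<Sum>j<N. \<Sum>r<L. tau 1 (twisted_power (2 * h) 1 (2 * int j, int r)))
      = of_nat L * (of_bool (b2 n - 1 \<ge> b2 N) * of_nat (gcd N n))" .
  have "tau 1 (twisted_power (2 * h) 1 (2 * int j + 1, int r))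
      = chi N \<alpha> (int h * (2 * int j + 1)) * chi L \<beta> (int h * (2 * int r + 1))" for j r
    using tau_eq_chi[of 1 "int h * (2 * int j + 1)" "- (int h * (2 * int r + 1))"]
    unfolding twisted_power_1 chi_minus by (simp add: mult.assoc)
  then have odd: "(\<Sum>j<N. \<Sum>r<L. tau 1 (twisted_power (2 * h) 1 (2 * int j + 1, int r)))
      = (\<Sum>j<N. chi N \<alpha> (int h * (2 * int j + 1))) * (\<Sum>r<L. chi L \<beta> (int h * (2 * int r + 1)))"
    by (simp only: sum_product)
  have L: "L > 0" "N > 0" using L_ge N_pos by auto
  show ?thesis
    unfolding h sum even[unfolded h] odd sum_chi_odd[OF L(1) \<open>h > 0\<close>] sum_chi_odd[OF L(2) \<open>h > 0\<close>]
    by (simp only: mult.assoc)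
qed

text \<open>Each of the two types supplies one term \<open>L * gcd N n\<close>, which explains the
  factor 2.\<close>

lemma fs_indicator_suzuki:
  assumes cond: "\<not> (even N \<and> \<alpha> = 1)" and n: "n \<ge> 1"
  shows "fs_indicator n H =
      of_nat (gcd N n * gcd L n)
    + of_bool (b2 n - 1 \<ge> b2 N) * of_nat (2 * L * gcd N n)
    + of_bool (b2 n - 1 \<ge> b2 N \<and> b2 n - 1 \<ge> b2 L)
        * eps_NL N L \<alpha> \<beta> n * of_nat (gcd N n * gcd L n)"
proof (cases "even n")
  case True
  \<comment> \<open>If \<open>\<alpha> = 1\<close>, then \<open>N\<close> is odd, both brackets on
    the right agree and the signs cancel; if \<open>\<alpha> = - 1\<close>, the first factor is
    1.\<close>
  have "\<alpha> ^ of_bool (b2 n = b2 N + 1) = (- \<alpha>) ^ of_bool (b2 n = 1) * (- 1) ^ of_bool (b2 n = b2 N + 1)"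
  proof (cases "\<alpha> = 1")
    case True
    then have "b2 N = 0" using cond N_pos by (simp add: b2_eq_0_iff)
    with True show ?thesis by (cases "b2 n = 1") auto
  next
    case False
    then have "\<alpha> = - 1" using alpha by simp
    then show ?thesis by simp
  qed
  then show ?thesis
    unfolding fs_indicator_eq[OF n] using n True
    by (simp add: power_sum_0 power_sum_1[OF _ True cond] eps_NL_def of_bool_conj algebra_simps)
next
  case False
  then have "b2 n = 0" using n by (simp add: b2_eq_0_iff)
  then have "\<not> b2 n - 1 \<ge> b2 N" using b2_nonneg[of N] by linarith
  then show ?thesis
    unfolding fs_indicator_eq[OF n] using n False by (simp add: power_sum_0)
qed

end

theorem theorem5p11:
  fixes N L n :: nat and \<alpha> \<beta> :: complex
  assumes "N \<ge> 1" and "L \<ge> 2"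
    and "\<alpha> \<in> {1, - 1}" and "\<beta> \<in> {1, - 1}"
    and "\<not> (even N \<and> \<alpha> = 1)"
    and "n \<ge> 1"
  shows "fs_indicator n (suzuki_hopf N L \<alpha> \<beta>) =
      of_nat (gcd N n * gcd L n)
    + of_bool (b2 n - 1 \<ge> b2 N) * of_nat (2 * L * gcd N n)
    + of_bool (b2 n - 1 \<ge> b2 N \<and> b2 n - 1 \<ge> b2 L)
        * eps_NL N L \<alpha> \<beta> n * of_nat (gcd N n * gcd L n)"
proof -
  interpret suzuki N L \<alpha> \<beta> by unfold_locales (use assms in auto)
  show ?thesis using assms by (intro fs_indicator_suzuki) auto
qed

end
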